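(* Thompson's group $F$ has infinite weak cop number, i.e. $\operatorname{wCop}(F)=\infty$.
   Context: **Thompson's group $F$.** $F$ is the group (under composition) of orientation-preserving, piecewise linear homeomorphisms of the unit interval $[0,1]$ with finitely many non-differentiable points, all of which are dyadic rationals, and whose slopes are all powers of $2$. It is a finitely generated group. **Graphs.** Graphs are simple and undirected. In a connected graph, $\mathsf{dist}$ denotes the path metric on vertices. For a group $K$ with generating set $S$ not containing the identity, $\operatorname{Cay}(K,S)$ is the graph with vertex set $K$ and edge set $\{\{g,gs\}: g\in K, s\in S\}$. **Weak Cops and Robbers.** Let $\Gamma$ be a connected graph and let $n,\sigma,\rho,\psi,R$ be positive integers and $v\in V(\Gamma)$. Here $n$ is the number of cops, $\sigma$ and $\rho$ are the speed and reach of the cops, $\psi$ is the speed of the robber, and $R$, $v$ are the radius and center of the area of play. It is a perfect information game. First each of the $n$ cops chooses an initial vertex; then, knowing these choices, the robber chooses an initial vertex. Then the cops and the robber move in alternating turns, starting with the cops. On the cops' turn, each cop can move to a vertex at distance at most $\sigma$ from its current position; the robber is captured during this turn if some cop moves to within distance $\rho$ of the robber. On the robber's turn, he can move to a vertex at distance at most $\psi$ from his current position, provided he has a path to that vertex containing no vertex within distance $\rho$ of any of the cops. The cops win (they "eventually protect the ball of radius $R$ centered at $v$") if either the robber is captured at some turn or, beginning on some turn, they permanently prevent the robber from moving within distance $R$ of $v$. $\Gamma$ is $\mathrm{CopWin}(n,\sigma,\rho,\psi,R)$ if for every $v\in V(\Gamma)$, $n$ cops with speed $\sigma$ and reach $\rho$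 have a strategy to eventually protect the ball of radius $R$ centered at $v$ against a robber of speed $\psi$. $\Gamma$ is $n$-weak cop win if there exist $\sigma,\rho$ such that for all $\psi,R$, $\Gamma$ is $\mathrm{CopWin}(n,\sigma,\rho,\psi,R)$. The weak cop number $\operatorname{wCop}(\Gamma)$ is the smallest $n$ such that $\Gamma$ is $n$-weak cop win, and $\operatorname{wCop}(\Gamma)=\infty$ if there is no such $n$. **Weak cop number of a group.** For a finitely generated group $K$, $\operatorname{wCop}(K)$ is defined as $\operatorname{wCop}(\operatorname{Cay}(K,S))$ for any finite generating set $S$ of $K$; it is known that this does not depend on the choice of $S$. *)

theory Defs
  imports
    "HOL-Analysis.Analysis"
    "HOL-Algebra.Bij"
    "HOL-Algebra.Generated_Groups"
    "HOL-Library.Extended_Nat"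
begin

section \<open>Graphs\<close>

record 'v ugraph =
  verts :: "'v set"
  edges :: "'v set set"

definition walk_betw :: "'v ugraph \<Rightarrow> 'v \<Rightarrow> 'v list \<Rightarrow> 'v \<Rightarrow> bool" where
  "walk_betw \<Gamma> u p w \<longleftrightarrow>
     p \<noteq> [] \<and> set p \<subseteq> verts \<Gamma> \<and> hd p = u \<and> last p = w \<and>
     successively (\<lambda>x y. {x, y} \<in> edges \<Gamma>) p"

text \<open>The path metric. It takes the value \<open>\<infinity>\<close> exactly when no walk joins the two vertices, which
  does not happen in a connected graph.\<close>

definition gdist :: "'v ugraph \<Rightarrow> 'v \<Rightarrow> 'v \<Rightarrow> enat" where
  "gdist \<Gamma> u w = (INF p\<in>{p. walk_betw \<Gamma> u p w}. enat (length p - 1))"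

definition Cay :: "('g, 'm) monoid_scheme \<Rightarrow> 'g set \<Rightarrow> 'g ugraph" where
  "Cay K S = \<lparr>verts = carrier K, edges = {{g, g \<otimes>\<^bsub>K\<^esub> s} | g s. g \<in> carrier K \<and> s \<in> S}\<rparr>"


section \<open>Weak Cops and Robbers\<close>

text \<open>The positions of the \<open>n\<close> cops form a list of length \<open>n\<close>.\<close>

definition within_reach :: "'v ugraph \<Rightarrow> nat \<Rightarrow> 'v list \<Rightarrow> 'v \<Rightarrow> bool" where
  "within_reach \<Gamma> \<rho> C x \<longleftrightarrow> (\<exists>c\<in>set C. gdist \<Gamma> c x \<le> enat \<rho>)"

text \<open>The vertex that the robber moves to is at distance at most \<open>\<psi>\<close>; the length of the path that
  he uses to get there is not restricted.\<close>

definition robber_move :: "'v ugraph \<Rightarrow> nat \<Rightarrow> nat \<Rightarrow> 'v list \<Rightarrow> 'v \<Rightarrow> 'v \<Rightarrow> bool" where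
  "robber_move \<Gamma> \<rho> \<psi> C x y \<longleftrightarrow>
     gdist \<Gamma> x y \<le> enat \<psi> \<and>
     (\<exists>p. walk_betw \<Gamma> x p y \<and> (\<forall>z\<in>set p. \<not> within_reach \<Gamma> \<rho> C z))"

text \<open>A strategy \<open>s\<close> of the cops maps the list of all robber positions so far to the next position
  of the cops: \<open>s []\<close> is their initial position, and \<open>s [r\<^sub>0, \<dots>, r\<^sub>i]\<close> is their position after
  their turn number \<open>i + 1\<close>, when the robber has stood at \<open>r\<^sub>0, \<dots>, r\<^sub>i\<close>. The earlier moves of the
  cops are determined by \<open>s\<close>, so that this is the complete history of the game.\<close>

definition cop_strategy :: "'v ugraph \<Rightarrow> nat \<Rightarrow> nat \<Rightarrow> ('v list \<Rightarrow> 'v list) \<Rightarrow> bool" where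
  "cop_strategy \<Gamma> n \<sigma> s \<longleftrightarrow>
     (\<forall>h\<in>lists (verts \<Gamma>). length (s h) = n \<and> set (s h) \<subseteq> verts \<Gamma>) \<and>
     (\<forall>h\<in>lists (verts \<Gamma>). \<forall>x\<in>verts \<Gamma>. \<forall>j<n. gdist \<Gamma> (s h ! j) (s (h @ [x]) ! j) \<le> enat \<sigma>)"

text \<open>Below, \<open>r i\<close> is the robber's position after his turn number \<open>i\<close>, with \<open>r 0\<close> his initial
  vertex.\<close>

definition cops_after :: "('v list \<Rightarrow> 'v list) \<Rightarrow> (nat \<Rightarrow> 'v) \<Rightarrow> nat \<Rightarrow> 'v list" where
  "cops_after s r i = s (map r [0..<i])"

definition captured_at ::
  "'v ugraph \<Rightarrow> nat \<Rightarrow> ('v list \<Rightarrow> 'v list) \<Rightarrow> (nat \<Rightarrow> 'v) \<Rightarrow> nat \<Rightarrow> bool" where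
  "captured_at \<Gamma> \<rho> s r i \<longleftrightarrow> within_reach \<Gamma> \<rho> (cops_after s r (Suc i)) (r i)"

text \<open>The game ends when the robber is captured; the values of \<open>r\<close> after that are irrelevant.\<close>

definition robber_play ::
  "'v ugraph \<Rightarrow> nat \<Rightarrow> nat \<Rightarrow> ('v list \<Rightarrow> 'v list) \<Rightarrow> (nat \<Rightarrow> 'v) \<Rightarrow> bool" where
  "robber_play \<Gamma> \<rho> \<psi> s r \<longleftrightarrow>
     r 0 \<in> verts \<Gamma> \<and>
     (\<forall>i. (\<forall>j\<le>i. \<not> captured_at \<Gamma> \<rho> s r j) \<longrightarrow>
          robber_move \<Gamma> \<rho> \<psi> (cops_after s r (Suc i)) (r i) (r (Suc i)))"

definition CopWin :: "'v ugraph \<Rightarrow> nat \<Rightarrow> nat \<Rightarrow> nat \<Rightarrow> nat \<Rightarrow> nat \<Rightarrow> bool" where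
  "CopWin \<Gamma> n \<sigma> \<rho> \<psi> R \<longleftrightarrow>
     (\<forall>v\<in>verts \<Gamma>. \<exists>s. cop_strategy \<Gamma> n \<sigma> s \<and>
        (\<forall>r. robber_play \<Gamma> \<rho> \<psi> s r \<longrightarrow>
             (\<exists>i. captured_at \<Gamma> \<rho> s r i) \<or>
             (\<exists>T. \<forall>i\<ge>T. \<not> gdist \<Gamma> v (r i) \<le> enat R)))"

definition weak_cop_win :: "'v ugraph \<Rightarrow> nat \<Rightarrow> bool" where
  "weak_cop_win \<Gamma> n \<longleftrightarrow> (\<exists>\<sigma>>0. \<exists>\<rho>>0. \<forall>\<psi>>0. \<forall>R>0. CopWin \<Gamma> n \<sigma> \<rho> \<psi> R)"

text \<open>On \<^typ>\<open>enat\<close>, the infimum of a nonempty set is its least element and that of the empty set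
  is \<open>\<infinity>\<close>.\<close>

definition wCop :: "'v ugraph \<Rightarrow> enat" where
  "wCop \<Gamma> = (INF n\<in>{n. n > 0 \<and> weak_cop_win \<Gamma> n}. enat n)"


section \<open>Finite generating sets\<close>

definition finite_generating_set :: "('g, 'm) monoid_scheme \<Rightarrow> 'g set \<Rightarrow> bool" where
  "finite_generating_set K S \<longleftrightarrow>
     finite S \<and> S \<subseteq> carrier K \<and> \<one>\<^bsub>K\<^esub> \<notin> S \<and> generate K S = carrier K"


section \<open>Thompson's group F\<close>

definition dyadic_rationals :: "real set" where
  "dyadic_rationals = {of_int a / 2 ^ n | (a::int) (n::nat). True}"

text \<open>\<open>f\<close> is affine on every open subinterval of the unit interval that avoids a suitable finite
  set.\<close>

definition piecewise_linear_unit :: "(real \<Rightarrow> real) \<Rightarrow> bool" where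
  "piecewise_linear_unit f \<longleftrightarrow>
     (\<exists>P. finite P \<and>
        (\<forall>a b. a < b \<and> {a<..<b} \<subseteq> {0..1} - P \<longrightarrow>
               (\<exists>m c. \<forall>x\<in>{a<..<b}. f x = m * x + c)))"

text \<open>Differentiability at the two endpoints is one-sided.\<close>

definition non_diff_points :: "(real \<Rightarrow> real) \<Rightarrow> real set" where
  "non_diff_points f = {x\<in>{0..1}. \<not> f differentiable (at x within {0..1})}"

definition thompson_F_maps :: "(real \<Rightarrow> real) set" where
  "thompson_F_maps =
     {f \<in> Bij {0..1}.
        (\<exists>g. homeomorphism {0..1} {0..1} f g) \<and>
        strict_mono_on {0..1} f \<and>
        piecewise_linear_unit f \<and>
        finite (non_diff_points f) \<and>
        non_diff_points f \<subseteq> dyadic_rationals \<and>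
        (\<forall>x\<in>{0..1}. \<forall>d. (f has_real_derivative d) (at x within {0..1}) \<longrightarrow>
                          (\<exists>k::int. d = 2 powi k))}"

text \<open>In \<^const>\<open>BijGroup\<close>, whose elements are extensional functions, the product is composition and
  the unit is the identity restricted to the unit interval.\<close>

definition thompson_F :: "(real \<Rightarrow> real) monoid" where
  "thompson_F = (BijGroup {0..1})\<lparr>carrier := thompson_F_maps\<rparr>"

end

(* The logarithms (base 2) of the slopes at 0 and at 1 are homomorphisms from F to the integers, and two
   commuting elements supported on [0,1/2] and on [1/2,1] map to a basis of Z^2: so F retracts onto Z^2.
   Through the two homomorphisms every cop has a shadow in the plane, of bounded speed and bounded reach.
   The robber fixes n + 1 rows and n + 1 columns, so far apart that a cop endangers at most one of each.
   He always stands on a row that stays clear during the next turn of the cops; after that turn he runs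
   along it to a column that is clear, and along the column to a row that is safe for another turn.
   All his stops lie in a fixed finite set. *)

theory Submission
  imports Defs "HOL-Algebra.Elementary_Groups"
begin

section \<open>The robber on a grid\<close>

text \<open>The speed and reach of the cops are fixed before the speed of the robber and the radius.
  So the grid is spaced according to the former, and only then are the latter two chosen, both equal
  to one bound for the distances between the finitely many stops. A move of the robber limits only
  the distance between its ends, so his detour along a row and a column may be as long as it likes,
  provided that it is free. On the algebraic side the obstacle is that F is closed under composition
  and inverses. A kink of \<open>f \<circ> g\<close> may lie at a preimage under \<open>g\<close> of
  a kink of \<open>f\<close>, so preimages of dyadic points have to be dyadic, which the definition
  of \<open>thompson_F_maps\<close> does not state. The maps are therefore extended to the whole
  line and described by one-sided germs, for which the chain rule is the addition of exponents. The
  same exponents, taken at 0 and at 1, are the two homomorphisms.\<close>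

lemma walk_betw_singleton: "u \<in> verts \<Gamma> \<Longrightarrow> walk_betw \<Gamma> u [u] u"
  by (simp add: walk_betw_def)

lemma walk_betw_rev: "walk_betw \<Gamma> u p w \<Longrightarrow> walk_betw \<Gamma> w (rev p) u"
  by (auto simp: walk_betw_def hd_rev last_rev insert_commute)

lemma walk_betw_trans:
  assumes "walk_betw \<Gamma> u p v" "walk_betw \<Gamma> v q w"
  shows "walk_betw \<Gamma> u (p @ tl q) w"
proof (cases "tl q = []")
  case True
  then have "q = [v]"
    using assms(2) by (cases q) (auto simp: walk_betw_def)
  then show ?thesis
    using assms by (simp add: walk_betw_def)
next
  case False
  then obtain y q' where q: "q = v # y # q'"
    using assms(2) by (cases q; cases "tl q") (auto simp: walk_betw_def)
  show ?thesis
    using assms unfolding q by (auto simp: walk_betw_def successively_append_iff)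
qed

lemma gdist_le_length: "walk_betw \<Gamma> u p w \<Longrightarrow> gdist \<Gamma> u w \<le> enat (length p - 1)"
  unfolding gdist_def by (rule INF_lower) simp

lemma gdist_le_enatE:
  assumes "gdist \<Gamma> u w \<le> enat k"
  obtains p where "walk_betw \<Gamma> u p w" "length p - 1 \<le> k"
proof -
  let ?A = "(\<lambda>p. enat (length p - 1)) ` {p. walk_betw \<Gamma> u p w}"
  have "?A \<noteq> {}"
  proof
    assume "?A = {}"
    then have "gdist \<Gamma> u w = \<infinity>"
      by (simp only: gdist_def Inf_empty top_enat_def)
    then show False
      using assms by simp
  qed
  then have "Inf ?A \<in> ?A"
    by (meson ex_in_conv wellorder_InfI)
  then show thesis
    using assms that by (auto simp: gdist_def)
qed

section \<open>Integer coordinates that vary slowly along edges\<close>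

definition edge_lipschitz :: "'v ugraph \<Rightarrow> nat \<Rightarrow> ('v \<Rightarrow> int) \<Rightarrow> bool" where
  "edge_lipschitz \<Gamma> L \<phi> \<longleftrightarrow> (\<forall>x y. {x, y} \<in> edges \<Gamma> \<longrightarrow> \<bar>\<phi> x - \<phi> y\<bar> \<le> int L)"

lemma edge_lipschitz_walk:
  assumes "edge_lipschitz \<Gamma> L \<phi>" "walk_betw \<Gamma> u p w"
  shows "\<bar>\<phi> u - \<phi> w\<bar> \<le> int (L * (length p - 1))"
  using assms(2)
proof (induction p arbitrary: u rule: induct_list012)
  case (3 x y p)
  then have "walk_betw \<Gamma> y (y # p) w" and e: "{x, y} \<in> edges \<Gamma>" "u = x"
    by (auto simp: walk_betw_def)
  from "3.IH"(2)[OF this(1)] have "\<bar>\<phi> y - \<phi> w\<bar> \<le> int (L * length p)"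
    by simp
  moreover have "\<bar>\<phi> u - \<phi> y\<bar> \<le> int L"
    using assms(1) e by (auto simp: edge_lipschitz_def)
  ultimately show ?case
    by (simp add: algebra_simps)
qed (auto simp: walk_betw_def)

lemma edge_lipschitz_gdist:
  assumes "edge_lipschitz \<Gamma> L \<phi>" "gdist \<Gamma> u w \<le> enat k"
  shows "\<bar>\<phi> u - \<phi> w\<bar> \<le> int (L * k)"
proof -
  obtain p where p: "walk_betw \<Gamma> u p w" "length p - 1 \<le> k"
    using assms(2) by (rule gdist_le_enatE)
  have "int (L * (length p - 1)) \<le> int (L * k)"
    using p(2) by (simp only: of_nat_le_iff mult_le_mono2)
  then show ?thesis
    using edge_lipschitz_walk[OF assms(1) p(1)] by linarith
qed

text \<open>Pigeonhole: distinct levels differ by at least \<open>2 * N + 1\<close>, so no cop has a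
  coordinate within \<open>N\<close> of two of them, and \<open>n\<close> cops cannot spoil all
  \<open>n + 1\<close> levels.\<close>

lemma ex_level_avoiding:
  fixes \<phi> :: "'v \<Rightarrow> int"
  assumes "length C = n"
  shows "\<exists>i\<le>n. \<forall>c\<in>set C. \<bar>\<phi> c - int (i * (2 * N + 1))\<bar> > int N"
proof (rule ccontr)
  assume "\<not> ?thesis"
  then have "\<forall>i\<in>{..n}. \<exists>c\<in>set C. \<bar>\<phi> c - int (i * (2 * N + 1))\<bar> \<le> int N"
    by (auto simp: not_less)
  then obtain g where g: "\<And>i. i \<le> n \<Longrightarrow> g i \<in> set C"
      "\<And>i. i \<le> n \<Longrightarrow> \<bar>\<phi> (g i) - int (i * (2 * N + 1))\<bar> \<le> int N"
    by (metis atMost_iff)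
  have *: "i = j" if "i \<le> n" "j \<le> n" "g i = g j" "i \<le> j" for i j
  proof (rule ccontr)
    assume "i \<noteq> j"
    with that(4) have "Suc i * (2 * N + 1) \<le> j * (2 * N + 1)"
      by (intro mult_le_mono1) simp
    then have "int (i * (2 * N + 1)) + int (2 * N + 1) \<le> int (j * (2 * N + 1))"
      by (simp only: of_nat_add[symmetric] of_nat_le_iff) simp
    moreover have "int (2 * N + 1) = 2 * int N + 1"
      by simp
    ultimately show False
      using g(2)[OF that(1)] g(2)[OF that(2)] unfolding that(3) by linarith
  qed
  have "inj_on g {..n}"
    by (rule inj_onI) (metis * atMost_iff nat_le_linear)
  then have "card {..n} \<le> card (set C)"
    using g(1) by (intro card_inj_on_le[of g]) auto
  then show False
    using card_length[of C] assms by simp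
qed

text \<open>The play of a robber whose choice \<open>P\<close> depends only on the present position
  of the cops. The recursion builds the list of his positions, since \<open>s\<close> expects that
  list; the sequence of positions is read off from it afterwards.\<close>

primrec history :: "('v list \<Rightarrow> 'v list) \<Rightarrow> ('v list \<Rightarrow> 'v) \<Rightarrow> nat \<Rightarrow> 'v list" where
  "history s P 0 = []"
| "history s P (Suc i) = history s P i @ [P (s (history s P i))]"

lemma map_upt_history: "map (\<lambda>i. P (s (history s P i))) [0..<i] = history s P i"
  by (induction i) simp_all

text \<open>The vertices \<open>q i j\<close> are the crossings of a grid in the quadrant, with
  \<open>\<phi>\<close> as the column and \<open>\<xi>\<close> as the row coordinate. The slack
  \<open>M\<close> is there because walks along powers of a group element wobble around their
  line.\<close>

lemma not_weak_cop_win_grid: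
  fixes \<phi> \<xi> :: "'v \<Rightarrow> int" and q :: "nat \<Rightarrow> nat \<Rightarrow> 'v" and L M :: nat
  assumes lip: "edge_lipschitz \<Gamma> L \<phi>" "edge_lipschitz \<Gamma> L \<xi>"
    and row: "\<And>i i' j. \<exists>p. walk_betw \<Gamma> (q i j) p (q i' j) \<and> (\<forall>z\<in>set p. \<bar>\<xi> z - int j\<bar> \<le> int M)"
    and col: "\<And>i j j'. \<exists>p. walk_betw \<Gamma> (q i j) p (q i j') \<and> (\<forall>z\<in>set p. \<bar>\<phi> z - int i\<bar> \<le> int M)"
  shows "\<not> weak_cop_win \<Gamma> n"
proof
  assume "weak_cop_win \<Gamma> n"
  then obtain \<sigma> \<rho> where win: "\<And>\<psi> R. \<psi> > 0 \<Longrightarrow> R > 0 \<Longrightarrow> CopWin \<Gamma> n \<sigma> \<rho> \<psi> R"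
    unfolding weak_cop_win_def by blast
  have q_verts: "q i j \<in> verts \<Gamma>" for i j
    using row[of i j i] unfolding walk_betw_def by (metis hd_in_set subsetD)
  \<comment> \<open>The three losses to be absorbed: a cop's turn changes his coordinate by at most
    \<open>L * \<sigma>\<close>, his reach adds \<open>L * \<rho>\<close>, and the wobble of a line
    adds \<open>M\<close>.\<close>
  define N where "N = L * (\<sigma> + \<rho>) + M"
  define D where "D = 2 * N + 1"
  define B where "B = (\<lambda>(i, j). q (i * D) (j * D)) ` ({..n} \<times> {..n})"
  have finB: "finite B"
    unfolding B_def by simp
  have "\<forall>z\<in>B \<times> B. \<exists>k. gdist \<Gamma> (fst z) (snd z) \<le> enat k"
  proof (clarsimp simp: B_def)
    fix i j i' j'
    obtain p1 p2 where "walk_betw \<Gamma> (q (i * D) (j * D)) p1 (q (i' * D) (j * D))"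
        "walk_betw \<Gamma> (q (i' * D) (j * D)) p2 (q (i' * D) (j' * D))"
      using row col by metis
    from gdist_le_length[OF walk_betw_trans[OF this]]
    show "\<exists>k. gdist \<Gamma> (q (i * D) (j * D)) (q (i' * D) (j' * D)) \<le> enat k"
      by blast
  qed
  then obtain k where k: "\<And>x y. x \<in> B \<Longrightarrow> y \<in> B \<Longrightarrow> gdist \<Gamma> x y \<le> enat (k (x, y))"
    by (metis SigmaI fst_conv snd_conv)
  define \<psi> where "\<psi> = Suc (Max (k ` (B \<times> B)))"
  have \<psi>: "gdist \<Gamma> x y \<le> enat \<psi>" if "x \<in> B" "y \<in> B" for x y
  proof -
    have "k (x, y) \<le> \<psi>"
      unfolding \<psi>_def using that finB by (intro le_SucI Max_ge) auto
    then show ?thesis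
      using k[OF that] by (meson enat_ord_simps(1) order_trans)
  qed
  have "\<psi> > 0"
    by (simp add: \<psi>_def)
  \<comment> \<open>The centre is itself a stop. With radius \<open>\<psi>\<close> the ball contains
    every stop, so the cops could win only by a capture.\<close>
  define v where "v = q 0 0"
  have v: "v \<in> B"
    unfolding B_def v_def by force
  obtain s where s: "cop_strategy \<Gamma> n \<sigma> s"
    and s_win: "\<And>r. robber_play \<Gamma> \<rho> \<psi> s r \<Longrightarrow>
       (\<exists>i. captured_at \<Gamma> \<rho> s r i) \<or> (\<exists>T. \<forall>i\<ge>T. \<not> gdist \<Gamma> v (r i) \<le> enat \<psi>)"
    using win[OF \<open>\<psi> > 0\<close> \<open>\<psi> > 0\<close>] q_verts unfolding CopWin_def v_def by blast
  define level where "level f C = (SOME i. i \<le> n \<and> (\<forall>c\<in>set C. \<bar>f c - int (i * D)\<bar> > int N))"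
    for f :: "'v \<Rightarrow> int" and C
  have level: "level f C \<le> n" "\<And>c. c \<in> set C \<Longrightarrow> \<bar>f c - int (level f C * D)\<bar> > int N"
    if "length C = n" for f :: "'v \<Rightarrow> int" and C
    using someI_ex[OF ex_level_avoiding[OF that, where \<phi> = f and N = N]] unfolding level_def D_def by auto
  \<comment> \<open>Both lines are clear of \<open>C\<close>. The row must still be clear after the
    next turn of the cops; the column is then chosen afresh.\<close>
  define P where "P C = q (level \<phi> C * D) (level \<xi> C * D)" for C
  define H where "H = history s P"
  define r where "r i = P (s (H i))" for i
  have cops: "cops_after s r i = s (H i)" for i
    unfolding cops_after_def r_def H_def map_upt_history ..
  have H_Suc: "H (Suc i) = H i @ [r i]" for i
    by (simp add: H_def r_def)
  have H: "H i \<in> lists (verts \<Gamma>)" for i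
    by (induction i) (use q_verts in \<open>auto simp: H_Suc r_def P_def\<close>, auto simp: H_def)
  have len: "length (s (H i)) = n" for i
    using s H unfolding cop_strategy_def by blast
  have r_B: "r i \<in> B" for i
    unfolding r_def P_def B_def using level(1)[OF len] by auto
  have r_verts: "r i \<in> verts \<Gamma>" for i
    by (simp add: r_def P_def q_verts)
  have cop_step: "gdist \<Gamma> (s (H i) ! m) (s (H (Suc i)) ! m) \<le> enat \<sigma>" if "m < n" for i m
    using s H r_verts that unfolding cop_strategy_def H_Suc by blast
  \<comment> \<open>The row of the robber keeps a distance of more than \<open>L * \<rho> + M\<close> from the cops during their next turn.\<close>
  have row_free: "\<not> within_reach \<Gamma> \<rho> (s (H (Suc i))) z"
    if z: "\<bar>\<xi> z - int (level \<xi> (s (H i)) * D)\<bar> \<le> int M" for i z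
  proof
    assume "within_reach \<Gamma> \<rho> (s (H (Suc i))) z"
    then obtain m where m: "m < n" "gdist \<Gamma> (s (H (Suc i)) ! m) z \<le> enat \<rho>"
      unfolding within_reach_def by (metis in_set_conv_nth len)
    note edge_lipschitz_gdist[OF lip(2) m(2)] edge_lipschitz_gdist[OF lip(2) cop_step[OF m(1), of i]]
    moreover have "\<bar>\<xi> (s (H i) ! m) - int (level \<xi> (s (H i)) * D)\<bar> > int N"
      using level(2)[OF len] m(1) len nth_mem by metis
    ultimately show False
      using z unfolding N_def by (simp add: algebra_simps)
  qed
  \<comment> \<open>The column is chosen after the turn of the cops, so only their reach and the
    wobble count here.\<close>
  have col_free: "\<not> within_reach \<Gamma> \<rho> (s (H i)) z"
    if z: "\<bar>\<phi> z - int (level \<phi> (s (H i)) * D)\<bar> \<le> int M" for i z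
  proof
    assume "within_reach \<Gamma> \<rho> (s (H i)) z"
    then obtain c where c: "c \<in> set (s (H i))" "gdist \<Gamma> c z \<le> enat \<rho>"
      unfolding within_reach_def by blast
    have "\<bar>\<phi> c - int (level \<phi> (s (H i)) * D)\<bar> > int N"
      using level(2)[OF len] c(1) by blast
    moreover have "int (L * \<rho>) + int M \<le> int N"
      by (simp add: N_def algebra_simps)
    ultimately show False
      using edge_lipschitz_gdist[OF lip(1) c(2)] z by linarith
  qed
  have not_captured: "\<not> captured_at \<Gamma> \<rho> s r i" for i
  proof -
    \<comment> \<open>The walk from a crossing to itself given by \<open>row\<close> contains the
      crossing, which bounds its coordinate.\<close>
    obtain p where "walk_betw \<Gamma> (r i) p (r i)"
      "\<forall>z\<in>set p. \<bar>\<xi> z - int (level \<xi> (s (H i)) * D)\<bar> \<le> int M"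
      using row unfolding r_def P_def by blast
    then have "\<bar>\<xi> (r i) - int (level \<xi> (s (H i)) * D)\<bar> \<le> int M"
      unfolding walk_betw_def by (metis hd_in_set)
    then show ?thesis
      unfolding captured_at_def cops by (rule row_free)
  qed
  have "robber_move \<Gamma> \<rho> \<psi> (cops_after s r (Suc i)) (r i) (r (Suc i))" for i
  proof -
    let ?C = "s (H i)" and ?C' = "s (H (Suc i))"
    \<comment> \<open>The corner of the route, where the old row meets the new column.\<close>
    let ?x = "q (level \<phi> ?C' * D) (level \<xi> ?C * D)"
    obtain p1 p2 where p1: "walk_betw \<Gamma> (r i) p1 ?x"
        "\<And>z. z \<in> set p1 \<Longrightarrow> \<bar>\<xi> z - int (level \<xi> ?C * D)\<bar> \<le> int M"
      and p2: "walk_betw \<Gamma> ?x p2 (r (Suc i))"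
        "\<And>z. z \<in> set p2 \<Longrightarrow> \<bar>\<phi> z - int (level \<phi> ?C' * D)\<bar> \<le> int M"
      using row col unfolding r_def P_def by metis
    have "z \<in> set p1 \<or> z \<in> set p2" if "z \<in> set (p1 @ tl p2)" for z
      using that by (cases p2) auto
    then have "\<not> within_reach \<Gamma> \<rho> ?C' z" if "z \<in> set (p1 @ tl p2)" for z
      using that p1(2) p2(2) row_free col_free by metis
    then show ?thesis
      unfolding robber_move_def cops using \<psi>[OF r_B r_B] walk_betw_trans[OF p1(1) p2(1)] by blast
  qed
  then have "robber_play \<Gamma> \<rho> \<psi> s r"
    unfolding robber_play_def using r_verts by blast
  then show False
    using s_win not_captured \<psi>[OF v r_B] by blast
qed

lemma wCop_eq_infinity: "(\<And>n. \<not> weak_cop_win \<Gamma> n) \<Longrightarrow> wCop \<Gamma> = \<infinity>"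
  by (simp add: wCop_def top_enat_def)

section \<open>Cayley graphs of groups with a retraction onto the integer lattice\<close>

context group
begin

text \<open>Edges come from right multiplication, so left translations are automorphisms of the
  Cayley graph.\<close>

lemma walk_betw_Cay_mult:
  assumes "walk_betw (Cay G S) x p y" "h \<in> carrier G" "S \<subseteq> carrier G"
  shows "walk_betw (Cay G S) (h \<otimes> x) (map ((\<otimes>) h) p) (h \<otimes> y)"
proof -
  have edge: "{h \<otimes> u, h \<otimes> w} \<in> edges (Cay G S)" if uw: "{u, w} \<in> edges (Cay G S)" for u w
  proof -
    from uw obtain g s where gs: "{u, w} = {g, g \<otimes> s}" "g \<in> carrier G" "s \<in> S"
      by (auto simp: Cay_def)
    then have "{h \<otimes> u, h \<otimes> w} = {h \<otimes> g, (h \<otimes> g) \<otimes> s}"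
      using assms(2,3) by (auto simp: doubleton_eq_iff m_assoc subset_iff)
    then show ?thesis
      using gs assms(2) by (auto simp: Cay_def)
  qed
  have "successively (\<lambda>u w. {h \<otimes> u, h \<otimes> w} \<in> edges (Cay G S)) p"
    using assms(1) edge by (auto simp: walk_betw_def elim!: successively_mono)
  moreover have "verts (Cay G S) = carrier G"
    by (simp add: Cay_def)
  ultimately show ?thesis
    using assms(1,2) by (auto simp: walk_betw_def hd_map last_map successively_map)
qed

lemma ex_walk_betw_Cay_generate:
  assumes "S \<subseteq> carrier G" "k \<in> generate G S"
  shows "\<exists>p. walk_betw (Cay G S) \<one> p k"
  using assms(2)
proof induction
  case one
  show ?case
    using walk_betw_singleton[of "\<one>" "Cay G S"] by (auto simp: Cay_def)
next
  case (incl s)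
  then have "{\<one>, \<one> \<otimes> s} \<in> edges (Cay G S)"
    unfolding Cay_def by auto
  moreover have "s \<in> carrier G"
    using incl assms(1) by auto
  ultimately have "walk_betw (Cay G S) \<one> [\<one>, s] s"
    by (simp add: walk_betw_def) (simp add: Cay_def)
  then show ?case ..
next
  case (inv s)
  \<comment> \<open>The edge that the generator \<open>s\<close> gives at \<open>inv s\<close> ends
    at the identity; it is walked backwards.\<close>
  then have "{inv s, inv s \<otimes> s} \<in> edges (Cay G S)"
    unfolding Cay_def using assms(1) by auto
  moreover have "s \<in> carrier G"
    using inv assms(1) by auto
  ultimately have "walk_betw (Cay G S) \<one> [\<one>, inv s] (inv s)"
    by (simp add: walk_betw_def insert_commute) (simp add: Cay_def)
  then show ?case ..
next
  case (eng h1 h2)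
  then obtain p1 p2 where p: "walk_betw (Cay G S) \<one> p1 h1" "walk_betw (Cay G S) \<one> p2 h2"
    by blast
  have h1: "h1 \<in> carrier G"
    using generate_in_carrier[OF assms(1)] eng by blast
  then have "walk_betw (Cay G S) h1 (map ((\<otimes>) h1) p2) (h1 \<otimes> h2)"
    using walk_betw_Cay_mult[OF p(2) h1 assms(1)] by simp
  from walk_betw_trans[OF p(1) this] show ?case ..
qed

lemma hom_integer_group_pow:
  assumes "f \<in> hom G integer_group" "c \<in> carrier G"
  shows "f (c [^] (m::nat)) = int m * f c"
  using hom_mult[OF assms(1)] hom_one[OF assms(1) group_axioms group_integer_group] assms(2)
  by (induction m) (auto simp: algebra_simps)

text \<open>Translates of one fixed walk from the identity to \<open>c\<close> are strung together.
  As \<open>f c = 0\<close>, every translate starts at the same value of \<open>f\<close>, so the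
  maximum of \<open>\<bar>f\<bar>\<close> on the fixed walk bounds the deviation uniformly in
  \<open>x\<close> and \<open>m\<close>.\<close>

lemma ex_walk_betw_Cay_powers:
  assumes S: "S \<subseteq> carrier G" and c: "c \<in> generate G S"
    and f: "f \<in> hom G integer_group" "f c = 0"
  shows "\<exists>M. \<forall>x\<in>carrier G. \<forall>m::nat. \<exists>p. walk_betw (Cay G S) x p (x \<otimes> c [^] m) \<and>
           (\<forall>z\<in>set p. \<bar>f z - f x\<bar> \<le> int M)"
proof -
  have cG: "c \<in> carrier G"
    using generate_in_carrier[OF S c] .
  have f_mult: "f (x \<otimes> y) = f x + f y" if "x \<in> carrier G" "y \<in> carrier G" for x y
    using hom_mult[OF f(1) that] by simp
  have f_pow: "f (c [^] m) = 0" for m :: nat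
    using hom_integer_group_pow[OF f(1) cG] f(2) by simp
  obtain w where w: "walk_betw (Cay G S) \<one> w c"
    using ex_walk_betw_Cay_generate[OF S c] ..
  define M where "M = nat (Max ((\<lambda>z. \<bar>f z\<bar>) ` set w))"
  have M: "\<bar>f z\<bar> \<le> int M" if "z \<in> set w" for z
  proof -
    have "\<bar>f z\<bar> \<le> Max ((\<lambda>z. \<bar>f z\<bar>) ` set w)"
      using that by (intro Max_ge) auto
    then show ?thesis
      unfolding M_def by linarith
  qed
  have wG: "set w \<subseteq> carrier G"
    using w by (simp add: walk_betw_def Cay_def)
  have "\<exists>p. walk_betw (Cay G S) x p (x \<otimes> c [^] m) \<and> (\<forall>z\<in>set p. \<bar>f z - f x\<bar> \<le> int M)"
    if x: "x \<in> carrier G" for x and m :: nat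
  proof (induction m)
    case 0
    show ?case
      using walk_betw_singleton[of x "Cay G S"] x by (intro exI[of _ "[x]"]) (simp add: Cay_def)
  next
    case (Suc m)
    then obtain p where p: "walk_betw (Cay G S) x p (x \<otimes> c [^] m)"
        "\<And>z. z \<in> set p \<Longrightarrow> \<bar>f z - f x\<bar> \<le> int M"
      by blast
    define q where "q = map ((\<otimes>) (x \<otimes> c [^] m)) w"
    have q: "walk_betw (Cay G S) (x \<otimes> c [^] m) q (x \<otimes> c [^] Suc m)"
      using walk_betw_Cay_mult[OF w _ S, of "x \<otimes> c [^] m"] x cG by (simp add: q_def m_assoc)
    have "\<bar>f z - f x\<bar> \<le> int M" if "z \<in> set q" for z
      using that x cG M wG f_pow by (auto simp: q_def f_mult subset_iff)
    moreover have "set (tl q) \<subseteq> set q"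
      by (cases q) auto
    ultimately have "\<forall>z\<in>set (p @ tl q). \<bar>f z - f x\<bar> \<le> int M"
      using p(2) by auto
    then show ?case
      using walk_betw_trans[OF p(1) q] by blast
  qed
  then show ?thesis
    by blast
qed

lemma ex_edge_lipschitz_hom:
  assumes "finite S" "S \<subseteq> carrier G" "f \<in> hom G integer_group"
  shows "\<exists>L. edge_lipschitz (Cay G S) L f"
proof -
  define L where "L = nat (Max (insert 0 ((\<lambda>s. \<bar>f s\<bar>) ` S)))"
  have L: "\<bar>f s\<bar> \<le> int L" if "s \<in> S" for s
  proof -
    have "\<bar>f s\<bar> \<le> Max (insert 0 ((\<lambda>s. \<bar>f s\<bar>) ` S))"
      using that assms(1) by (intro Max_ge) auto
    then show ?thesis
      unfolding L_def by linarith
  qed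
  have "\<bar>f x - f y\<bar> \<le> int L" if xy: "{x, y} \<in> edges (Cay G S)" for x y
  proof -
    from xy obtain g s where gs: "{x, y} = {g, g \<otimes> s}" "g \<in> carrier G" "s \<in> S"
      by (auto simp: Cay_def)
    have "f (g \<otimes> s) = f g + f s"
      using hom_mult[OF assms(3)] gs assms(2) by auto
    then show ?thesis
      using gs(1) L[OF gs(3)] by (auto simp: doubleton_eq_iff)
  qed
  then show ?thesis
    unfolding edge_lipschitz_def by blast
qed

text \<open>The crossings are the products of a power of \<open>a\<close> and a power of
  \<open>b\<close>. Walks realise right multiplication; since \<open>a\<close> and \<open>b\<close>
  commute, multiplying on the right by either of them moves along a line of the grid.\<close>

theorem wCop_Cay_eq_infinity:
  assumes S: "finite_generating_set G S"
    and f: "f \<in> hom G integer_group" and g: "g \<in> hom G integer_group"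
    and a: "a \<in> carrier G" and b: "b \<in> carrier G" and comm: "a \<otimes> b = b \<otimes> a"
    and vals: "f a = 1" "g a = 0" "f b = 0" "g b = 1"
  shows "wCop (Cay G S) = \<infinity>"
proof (rule wCop_eq_infinity)
  fix n
  have fin: "finite S" and SG: "S \<subseteq> carrier G" and gen: "generate G S = carrier G"
    using S by (auto simp: finite_generating_set_def)
  obtain Lf Lg where "edge_lipschitz (Cay G S) Lf f" "edge_lipschitz (Cay G S) Lg g"
    using ex_edge_lipschitz_hom[OF fin SG] f g by blast
  then have lip: "edge_lipschitz (Cay G S) (max Lf Lg) f" "edge_lipschitz (Cay G S) (max Lf Lg) g"
    unfolding edge_lipschitz_def by (meson max.cobounded1 max.cobounded2 of_nat_mono order_trans)+
  define q where "q i j = a [^] i \<otimes> b [^] j" for i j :: nat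
  have qG: "q i j \<in> carrier G" for i j
    using a b by (simp add: q_def)
  have row_eq: "q i j \<otimes> a [^] m = q (i + m) j" for i j m
  proof -
    have "b [^] j \<otimes> a [^] m = a [^] m \<otimes> b [^] j"
      using group_commutes_pow a b comm by (metis nat_pow_closed)
    then show ?thesis
      using a b by (simp add: q_def m_assoc nat_pow_mult[symmetric])
  qed
  have col_eq: "q i j \<otimes> b [^] m = q i (j + m)" for i j m
    using a b by (simp add: q_def m_assoc nat_pow_mult)
  have q_vals: "f (q i j) = int i" "g (q i j) = int j" for i j
    using hom_mult[OF f] hom_mult[OF g] a b vals
    by (simp_all add: q_def hom_integer_group_pow[OF f] hom_integer_group_pow[OF g])
  obtain Ma where Ma: "\<And>x m. x \<in> carrier G \<Longrightarrow>
      \<exists>p. walk_betw (Cay G S) x p (x \<otimes> a [^] (m::nat)) \<and> (\<forall>z\<in>set p. \<bar>g z - g x\<bar> \<le> int Ma)"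
    using ex_walk_betw_Cay_powers[OF SG _ g] a vals gen by metis
  obtain Mb where Mb: "\<And>x m. x \<in> carrier G \<Longrightarrow>
      \<exists>p. walk_betw (Cay G S) x p (x \<otimes> b [^] (m::nat)) \<and> (\<forall>z\<in>set p. \<bar>f z - f x\<bar> \<le> int Mb)"
    using ex_walk_betw_Cay_powers[OF SG _ f] b vals gen by metis
  let ?M = "max Ma Mb"
  \<comment> \<open>Natural powers lead only to larger indices; reversed walks give the other
    direction.\<close>
  have row_le: "\<exists>p. walk_betw (Cay G S) (q i j) p (q i' j) \<and> (\<forall>z\<in>set p. \<bar>g z - int j\<bar> \<le> int ?M)"
    if "i \<le> i'" for i i' j
    using Ma[OF qG, of i j "i' - i"] that unfolding row_eq q_vals by fastforce
  have col_le: "\<exists>p. walk_betw (Cay G S) (q i j) p (q i j') \<and> (\<forall>z\<in>set p. \<bar>f z - int i\<bar> \<le> int ?M)"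
    if "j \<le> j'" for i j j'
    using Mb[OF qG, of i j "j' - j"] that unfolding col_eq q_vals by fastforce
  show "\<not> weak_cop_win (Cay G S) n"
  proof (rule not_weak_cop_win_grid[OF lip])
    show "\<exists>p. walk_betw (Cay G S) (q i j) p (q i' j) \<and> (\<forall>z\<in>set p. \<bar>g z - int j\<bar> \<le> int ?M)" for i i' j
      by (metis row_le nat_le_linear walk_betw_rev set_rev)
    show "\<exists>p. walk_betw (Cay G S) (q i j) p (q i j') \<and> (\<forall>z\<in>set p. \<bar>f z - int i\<bar> \<le> int ?M)" for i j j'
      by (metis col_le nat_le_linear walk_betw_rev set_rev)
  qed
qed

end

section \<open>Dyadic piecewise linear homeomorphisms\<close>

text \<open>To the right of \<open>x\<close> for \<open>\<sigma> = 1\<close>, to the left for \<open>\<sigma> = - 1\<close>.\<close>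

definition germ :: "real \<Rightarrow> (real \<Rightarrow> real) \<Rightarrow> real \<Rightarrow> int \<Rightarrow> bool" where
  "germ \<sigma> f x k \<longleftrightarrow> (\<exists>e>0. \<forall>t. 0 \<le> t \<and> t < e \<longrightarrow> f (x + \<sigma> * t) = f x + \<sigma> * (2 powi k * t))"

section \<open>Calculus of one-sided germs\<close>

lemma two_powi_inject: "(2::real) powi k = 2 powi l \<longleftrightarrow> k = l"
  by (metis linorder_neqE one_less_numeral_iff order_less_irrefl power_int_strict_increasing semiring_norm(76))

lemma germ_unique:
  assumes "germ \<sigma> f x k" "germ \<sigma> f x l" "\<sigma> \<noteq> 0"
  shows "k = l"
proof -
  obtain e where e: "e > 0" "\<And>t. 0 \<le> t \<Longrightarrow> t < e \<Longrightarrow> f (x + \<sigma> * t) = f x + \<sigma> * (2 powi k * t)"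
    using assms(1) unfolding germ_def by blast
  obtain d where d: "d > 0" "\<And>t. 0 \<le> t \<Longrightarrow> t < d \<Longrightarrow> f (x + \<sigma> * t) = f x + \<sigma> * (2 powi l * t)"
    using assms(2) unfolding germ_def by blast
  define t where "t = min e d / 2"
  have t: "0 < t" "t < e" "t < d"
    using e(1) d(1) by (auto simp: t_def min_def)
  then have "\<sigma> * (2 powi k * t) = \<sigma> * (2 powi l * t)"
    using e(2)[of t] d(2)[of t] by linarith
  then have "(2::real) powi k = 2 powi l"
    using assms(3) t(1) by auto
  then show ?thesis
    by (simp add: two_powi_inject)
qed

lemma germ_id: "germ \<sigma> id x 0"
  unfolding germ_def by (intro exI[of _ 1]) simp

lemma germ_cong:
  assumes "germ \<sigma> f x k" "f x = g x" "e > 0" "\<And>t. 0 < t \<Longrightarrow> t < e \<Longrightarrow> f (x + \<sigma> * t) = g (x + \<sigma> * t)"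
  shows "germ \<sigma> g x k"
proof -
  obtain d where d: "d > 0" "\<And>t. 0 \<le> t \<Longrightarrow> t < d \<Longrightarrow> f (x + \<sigma> * t) = f x + \<sigma> * (2 powi k * t)"
    using assms(1) unfolding germ_def by blast
  have "g (x + \<sigma> * t) = g x + \<sigma> * (2 powi k * t)" if "0 \<le> t" "t < min d e" for t
    using d(2)[of t] assms(2) assms(4)[of t] that by (cases "t = 0") auto
  then show ?thesis
    unfolding germ_def using d(1) assms(3) by (intro exI[of _ "min d e"]) auto
qed

lemma germ_compose:
  assumes "germ \<sigma> g x k" "germ \<sigma> f (g x) l"
  shows "germ \<sigma> (f \<circ> g) x (k + l)"
proof -
  obtain e where e: "e > 0" "\<And>t. 0 \<le> t \<Longrightarrow> t < e \<Longrightarrow> g (x + \<sigma> * t) = g x + \<sigma> * (2 powi k * t)"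
    using assms(1) unfolding germ_def by blast
  obtain d where d: "d > 0" "\<And>t. 0 \<le> t \<Longrightarrow> t < d \<Longrightarrow> f (g x + \<sigma> * t) = f (g x) + \<sigma> * (2 powi l * t)"
    using assms(2) unfolding germ_def by blast
  have p: "0 < (2::real) powi k"
    by simp
  have "f (g (x + \<sigma> * t)) = f (g x) + \<sigma> * (2 powi (k + l) * t)"
    if "0 \<le> t" "t < min e (d / 2 powi k)" for t
  proof -
    have "2 powi k * t < d"
      using that(2) p by (simp add: pos_less_divide_eq mult.commute)
    then show ?thesis
      using e(2)[of t] d(2)[of "2 powi k * t"] that p by (simp add: power_int_add mult_ac)
  qed
  moreover have "0 < min e (d / 2 powi k)"
    using e(1) d(1) p by simp
  ultimately show ?thesis
    unfolding germ_def comp_apply by blast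
qed

lemma germ_inv:
  assumes "bij h" "germ \<sigma> h x k"
  shows "germ \<sigma> (inv_into UNIV h) (h x) (- k)"
proof -
  obtain e where e: "e > 0" "\<And>t. 0 \<le> t \<Longrightarrow> t < e \<Longrightarrow> h (x + \<sigma> * t) = h x + \<sigma> * (2 powi k * t)"
    using assms(2) unfolding germ_def by blast
  have p: "0 < (2::real) powi k"
    by simp
  have inv_h: "inv_into UNIV h (h y) = y" for y
    using assms(1) by (simp add: bij_is_inj)
  have "inv_into UNIV h (h x + \<sigma> * u) = x + \<sigma> * (2 powi (- k) * u)" if "0 \<le> u" "u < e * 2 powi k" for u
  proof -
    have "0 \<le> u / 2 powi k" "u / 2 powi k < e"
      using that p by (simp_all add: pos_divide_less_eq)
    from e(2)[OF this] have "h x + \<sigma> * u = h (x + \<sigma> * (u / 2 powi k))"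
      using p by simp
    then have "inv_into UNIV h (h x + \<sigma> * u) = x + \<sigma> * (u / 2 powi k)"
      by (simp only: inv_h)
    then show ?thesis
      by (simp add: power_int_minus_divide)
  qed
  then show ?thesis
    unfolding germ_def inv_h using e(1) p by (intro exI[of _ "e * 2 powi k"]) simp
qed

text \<open>A germ on one side is an affine piece, and the inner points of that piece see it on both
  sides.\<close>

lemma germ_nearby:
  assumes "germ \<sigma> f x k" "\<sigma> \<in> {1, -1}"
  shows "\<exists>e>0. \<forall>t. 0 < t \<and> t < e \<longrightarrow> f (x + \<sigma> * t) = f x + \<sigma> * (2 powi k * t) \<and>
           germ 1 f (x + \<sigma> * t) k \<and> germ (-1) f (x + \<sigma> * t) k"
proof -
  obtain e where e: "e > 0" "\<And>t. 0 \<le> t \<Longrightarrow> t < e \<Longrightarrow> f (x + \<sigma> * t) = f x + \<sigma> * (2 powi k * t)"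
    using assms(1) unfolding germ_def by blast
  have "germ \<tau> f (x + \<sigma> * t) k" if t: "0 < t" "t < e" and \<tau>: "\<tau> \<in> {1, -1}" for t \<tau>
    unfolding germ_def
  \<comment> \<open>The radius is the distance from \<open>t\<close> to the ends of the interval
    from 0 to \<open>e\<close>. As \<open>\<sigma> * \<sigma> = 1\<close>, a step of length
    \<open>u\<close> in direction \<open>\<tau>\<close> changes \<open>t\<close> by
    \<open>\<sigma> * \<tau> * u\<close>.\<close>
  proof (intro exI[of _ "min t (e - t)"] conjI allI impI)
    fix u assume u: "0 \<le> u \<and> u < min t (e - t)"
    have "x + \<sigma> * t + \<tau> * u = x + \<sigma> * (t + \<sigma> * \<tau> * u)"
      using assms(2) by auto
    moreover have "f (x + \<sigma> * (t + \<sigma> * \<tau> * u)) = f x + \<sigma> * (2 powi k * (t + \<sigma> * \<tau> * u))"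
      using u t \<tau> assms(2) by (intro e(2)) auto
    moreover have "\<sigma> * (2 powi k * (t + \<sigma> * \<tau> * u)) = \<sigma> * (2 powi k * t) + \<tau> * (2 powi k * u)"
      using assms(2) by (auto simp: algebra_simps)
    ultimately show "f (x + \<sigma> * t + \<tau> * u) = f (x + \<sigma> * t) + \<tau> * (2 powi k * u)"
      using e(2)[of t] t by (simp only: less_imp_le)
  qed (use t in auto)
  then show ?thesis
    using e by (intro exI[of _ e]) auto
qed

lemma germ_affineI:
  assumes f: "\<forall>y\<in>{a..b}. f y = 2 powi k * y + c" and x: "x \<in> {a..b}"
  shows "x < b \<Longrightarrow> germ 1 f x k" "a < x \<Longrightarrow> germ (-1) f x k"
proof -
  have affine: "f (x + s) = f x + 2 powi k * s" if "x + s \<in> {a..b}" for s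
    using bspec[OF f that] bspec[OF f x] by (simp add: distrib_left)
  show "germ 1 f x k" if "x < b"
    unfolding germ_def
  proof (intro exI[of _ "b - x"] conjI allI impI)
    fix t assume "0 \<le> t \<and> t < b - x"
    then show "f (x + 1 * t) = f x + 1 * (2 powi k * t)"
      using affine[of t] x by simp
  qed (use that in simp)
  show "germ (-1) f x k" if "a < x"
    unfolding germ_def
  proof (intro exI[of _ "x - a"] conjI allI impI)
    fix t assume "0 \<le> t \<and> t < x - a"
    then show "f (x + (-1) * t) = f x + (-1) * (2 powi k * t)"
      using affine[of "- t"] x by simp
  qed (use that in simp)
qed

lemma germ_reflect:
  assumes "germ \<sigma> h (1 - x) k"
  shows "germ (- \<sigma>) (\<lambda>x. 1 - h (1 - x)) x k"
proof -
  obtain e where e: "e > 0" "\<And>t. 0 \<le> t \<Longrightarrow> t < e \<Longrightarrow> h (1 - x + \<sigma> * t) = h (1 - x) + \<sigma> * (2 powi k * t)"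
    using assms unfolding germ_def by blast
  have "1 - (x + - \<sigma> * t) = 1 - x + \<sigma> * t" for t
    by simp
  then have "1 - h (1 - (x + - \<sigma> * t)) = 1 - h (1 - x) + - \<sigma> * (2 powi k * t)" if "0 \<le> t" "t < e" for t
    using e(2)[OF that] by (simp only:)
  then show ?thesis
    unfolding germ_def using e(1) by blast
qed

text \<open>The difference quotient is constant along the side of the germ, so one side inside
  \<open>A\<close> determines the derivative. At an end point of the unit interval there is only one
  such side.\<close>

lemma germ_has_derivative:
  assumes "germ \<sigma> f x k" "\<sigma> \<in> {1, -1}" "(f has_real_derivative d) (at x within A)"
    and "e > 0" "\<And>t. 0 < t \<Longrightarrow> t < e \<Longrightarrow> x + \<sigma> * t \<in> A"
  shows "d = 2 powi k"
proof -
  obtain e' where e': "e' > 0" "\<And>t. 0 \<le> t \<Longrightarrow> t < e' \<Longrightarrow> f (x + \<sigma> * t) = f x + \<sigma> * (2 powi k * t)"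
    using assms(1) unfolding germ_def by blast
  have \<sigma>: "\<sigma> \<noteq> 0"
    using assms(2) by auto
  have ev: "eventually (\<lambda>t. 0 < t \<and> t < min e e') (at_right (0::real))"
    using assms(4) e'(1) by (auto intro: eventually_at_rightI[of 0 "min e e'"])
  have "filterlim (\<lambda>t. x + \<sigma> * t) (at x within A) (at_right 0)"
    unfolding filterlim_at
  proof
    show "\<forall>\<^sub>F t in at_right 0. x + \<sigma> * t \<in> A \<and> x + \<sigma> * t \<noteq> x"
      using ev by eventually_elim (use assms(5) \<sigma> in auto)
    show "((\<lambda>t. x + \<sigma> * t) \<longlongrightarrow> x) (at_right 0)"
      by (auto intro!: tendsto_eq_intros)
  qed
  with assms(3) have "((\<lambda>t. (f (x + \<sigma> * t) - f x) / (x + \<sigma> * t - x)) \<longlongrightarrow> d) (at_right 0)"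
    unfolding has_field_derivative_iff by (rule filterlim_compose)
  moreover have "\<forall>\<^sub>F t in at_right 0. (f (x + \<sigma> * t) - f x) / (x + \<sigma> * t - x) = 2 powi k"
    using ev by eventually_elim (use e'(2) \<sigma> in auto)
  ultimately have "((\<lambda>t. 2 powi k) \<longlongrightarrow> d) (at_right (0::real))"
    by (rule Lim_transform_eventually)
  then show ?thesis
    using tendsto_unique[OF trivial_limit_at_right_real _ tendsto_const] by metis
qed

section \<open>The dyadic rationals as a ring containing all powers of 2\<close>

lemma dyadic_rationals_add: "x \<in> dyadic_rationals \<Longrightarrow> y \<in> dyadic_rationals \<Longrightarrow> x + y \<in> dyadic_rationals"
proof -
  assume "x \<in> dyadic_rationals" "y \<in> dyadic_rationals"
  then obtain a m b n where "x = of_int a / 2 ^ m" "y = of_int b / 2 ^ n"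
    by (auto simp: dyadic_rationals_def)
  then have "x + y = of_int (a * 2 ^ n + b * 2 ^ m) / 2 ^ (m + n)"
    by (simp add: add_divide_distrib power_add)
  then show ?thesis
    unfolding dyadic_rationals_def by blast
qed

lemma dyadic_rationals_mult: "x \<in> dyadic_rationals \<Longrightarrow> y \<in> dyadic_rationals \<Longrightarrow> x * y \<in> dyadic_rationals"
proof -
  assume "x \<in> dyadic_rationals" "y \<in> dyadic_rationals"
  then obtain a m b n where "x = of_int a / 2 ^ m" "y = of_int b / 2 ^ n"
    by (auto simp: dyadic_rationals_def)
  then have "x * y = of_int (a * b) / 2 ^ (m + n)"
    by (simp add: power_add)
  then show ?thesis
    unfolding dyadic_rationals_def by blast
qed

lemma dyadic_rationalsI: "of_int a / 2 ^ n \<in> dyadic_rationals"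
  unfolding dyadic_rationals_def by blast

lemma dyadic_rationals_of_int: "of_int a \<in> dyadic_rationals"
  using dyadic_rationalsI[of a 0] by simp

lemma dyadic_rationals_diff: "x \<in> dyadic_rationals \<Longrightarrow> y \<in> dyadic_rationals \<Longrightarrow> x - y \<in> dyadic_rationals"
  using dyadic_rationals_add[of x "- 1 * y"] dyadic_rationals_mult[of "- 1" y] dyadic_rationals_of_int[of "- 1"]
  by simp

lemma dyadic_rationals_powi: "2 powi k \<in> dyadic_rationals"
proof (cases "0 \<le> k")
  case True
  then show ?thesis
    using dyadic_rationals_of_int[of "2 ^ nat k"] by (simp add: power_int_def)
next
  case False
  then show ?thesis
    using dyadic_rationalsI[of 1 "nat (- k)"] by (simp add: power_int_def power_one_over inverse_eq_divide)
qed

text \<open>The conditions on kinks are pointwise, so that closure properties can be checked germ by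
  germ; compactness of the unit interval then makes the kinks finite in number. Being total on the
  line, the maps compose by \<open>\<circ>\<close> and every point has two sides.\<close>

definition dyadic_pl :: "(real \<Rightarrow> real) \<Rightarrow> bool" where
  "dyadic_pl h \<longleftrightarrow> bij h \<and> mono h \<and> (\<forall>x. x \<notin> {0<..<1} \<longrightarrow> h x = x) \<and>
     (\<forall>x. \<exists>k l. germ 1 h x k \<and> germ (-1) h x l \<and> (k = l \<or> x \<in> dyadic_rationals))"

lemma dyadic_plD:
  assumes "dyadic_pl h"
  shows "bij h" "mono h" "x \<notin> {0<..<1} \<Longrightarrow> h x = x"
    "\<exists>k l. germ 1 h x k \<and> germ (-1) h x l \<and> (k = l \<or> x \<in> dyadic_rationals)"
  using assms unfolding dyadic_pl_def by blast+

text \<open>One radius for both sides. This is the form used to see that slopes and intercepts are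
  locally constant and that kinks are isolated.\<close>

lemma dyadic_pl_local:
  assumes "dyadic_pl h"
  shows "\<exists>e k l. e > 0 \<and> (k = l \<or> x \<in> dyadic_rationals) \<and> germ 1 h x k \<and> germ (-1) h x l \<and>
    (\<forall>y. x < y \<and> y < x + e \<longrightarrow> h y = h x + 2 powi k * (y - x) \<and> germ 1 h y k \<and> germ (-1) h y k) \<and>
    (\<forall>y. x - e < y \<and> y < x \<longrightarrow> h y = h x + 2 powi l * (y - x) \<and> germ 1 h y l \<and> germ (-1) h y l)"
proof -
  obtain k l where kl: "germ 1 h x k" "germ (-1) h x l" "k = l \<or> x \<in> dyadic_rationals"
    using dyadic_plD(4)[OF assms] by blast
  obtain e where e: "e > 0" "\<forall>t. 0 < t \<and> t < e \<longrightarrow> h (x + 1 * t) = h x + 1 * (2 powi k * t) \<and>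
           germ 1 h (x + 1 * t) k \<and> germ (-1) h (x + 1 * t) k"
    using germ_nearby[OF kl(1)] by blast
  obtain d where d: "d > 0" "\<forall>t. 0 < t \<and> t < d \<longrightarrow> h (x + (-1) * t) = h x + (-1) * (2 powi l * t) \<and>
           germ 1 h (x + (-1) * t) l \<and> germ (-1) h (x + (-1) * t) l"
    using germ_nearby[OF kl(2)] by blast
  have "h y = h x + 2 powi k * (y - x) \<and> germ 1 h y k \<and> germ (-1) h y k"
    if "x < y \<and> y < x + min e d" for y
    using e(2)[rule_format, of "y - x"] that by auto
  moreover have "h y = h x + 2 powi l * (y - x) \<and> germ 1 h y l \<and> germ (-1) h y l"
    if "x - min e d < y \<and> y < x" for y
    using d(2)[rule_format, of "x - y"] that by (auto simp: algebra_simps)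
  moreover have "min e d > 0"
    using e(1) d(1) by simp
  ultimately show ?thesis
    using kl by blast
qed

lemma connected_real_equivalence_relation:
  fixes S :: "real set"
  assumes "connected S" "open S" "a \<in> S" "b \<in> S"
    and "\<And>x y. R x y \<Longrightarrow> R y x" "\<And>x y z. R x y \<Longrightarrow> R y z \<Longrightarrow> R x z"
    and loc: "\<And>x. x \<in> S \<Longrightarrow> \<exists>e>0. \<forall>y\<in>S. x - e < y \<and> y < x + e \<longrightarrow> R x y"
  shows "R a b"
proof (rule connected_equivalence_relation[OF assms(1,3,4)])
  fix x assume "x \<in> S"
  then obtain e where "e > 0" "\<forall>y\<in>S. x - e < y \<and> y < x + e \<longrightarrow> R x y"
    using loc by blast
  then show "\<exists>T. openin (top_of_set S) T \<and> x \<in> T \<and> (\<forall>y\<in>T. R x y)"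
    using \<open>x \<in> S\<close> by (intro exI[of _ "S \<inter> {x - e<..<x + e}"]) (auto intro: openin_open_Int)
qed (use assms(5,6) in blast)+

text \<open>The intercept \<open>h x - 2\<^sup>k x\<close> changes only at dyadic \<open>x\<close>, where it is dyadic iff \<open>h x\<close> is, whatever
  \<open>k\<close>; hence its being dyadic is a locally constant property, which holds at \<open>-1\<close>.\<close>

lemma dyadic_pl_dyadic_iff:
  assumes h: "dyadic_pl h"
  shows "h x \<in> dyadic_rationals \<longleftrightarrow> x \<in> dyadic_rationals"
proof -
  define Q where "Q x \<longleftrightarrow> (\<forall>\<sigma>\<in>{1, -1}. \<forall>k. germ \<sigma> h x k \<longrightarrow> h x - 2 powi k * x \<in> dyadic_rationals)" for x
  have Q_iff: "Q x \<longleftrightarrow> h x - 2 powi k * x \<in> dyadic_rationals \<and> h x - 2 powi l * x \<in> dyadic_rationals"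
    if "germ 1 h x k" "germ (-1) h x l" for x k l
  proof -
    have "germ 1 h x k' \<longleftrightarrow> k' = k" "germ (-1) h x k' \<longleftrightarrow> k' = l" for k'
      using that germ_unique[of _ h x k'] by fastforce+
    then show ?thesis
      by (auto simp: Q_def)
  qed
  have change: "h x - 2 powi k * x \<in> dyadic_rationals \<longleftrightarrow> h x \<in> dyadic_rationals"
    if "x \<in> dyadic_rationals" for x k
  proof -
    have "2 powi k * x \<in> dyadic_rationals"
      using dyadic_rationals_mult[OF dyadic_rationals_powi that] .
    then show ?thesis
      using dyadic_rationals_add[of "h x - 2 powi k * x" "2 powi k * x"]
        dyadic_rationals_diff[of "h x" "2 powi k * x"] by auto
  qed
  have "Q (-1) \<longleftrightarrow> Q x"
  proof (rule connected_real_equivalence_relation[of UNIV])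
    fix x :: real
    obtain e k l where e: "e > 0" "k = l \<or> x \<in> dyadic_rationals" "germ 1 h x k" "germ (-1) h x l"
    "\<forall>y. x < y \<and> y < x + e \<longrightarrow> h y = h x + 2 powi k * (y - x) \<and> germ 1 h y k \<and> germ (-1) h y k"
    "\<forall>y. x - e < y \<and> y < x \<longrightarrow> h y = h x + 2 powi l * (y - x) \<and> germ 1 h y l \<and> germ (-1) h y l"
      using dyadic_pl_local[OF h, of x] by blast
    \<comment> \<open>Either \<open>k = l\<close> and the two conditions of \<open>Q_iff\<close>
      coincide, or \<open>x\<close> is dyadic and both say that \<open>h x\<close> is.\<close>
    have Qx: "Q x \<longleftrightarrow> h x - 2 powi k * x \<in> dyadic_rationals" "Q x \<longleftrightarrow> h x - 2 powi l * x \<in> dyadic_rationals"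
      using Q_iff[OF e(3,4)] e(2) change by auto
    have "Q x \<longleftrightarrow> Q y" if y: "x - e < y" "y < x + e" for y
    proof (cases y x rule: linorder_cases)
      case less
      then have *: "h y = h x + 2 powi l * (y - x)" "germ 1 h y l" "germ (-1) h y l"
        using e(6) y by auto
      then have "h y - 2 powi l * y = h x - 2 powi l * x"
        by (simp add: algebra_simps)
      then show ?thesis
        using Q_iff[OF *(2,3)] Qx(2) by simp
    next
      case greater
      then have *: "h y = h x + 2 powi k * (y - x)" "germ 1 h y k" "germ (-1) h y k"
        using e(5) y by auto
      then have "h y - 2 powi k * y = h x - 2 powi k * x"
        by (simp add: algebra_simps)
      then show ?thesis
        using Q_iff[OF *(2,3)] Qx(1) by simp
    qed simp
    then show "\<exists>e>0. \<forall>y\<in>UNIV. x - e < y \<and> y < x + e \<longrightarrow> Q x = Q y"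
      using e(1) by blast
  qed auto
  moreover have "Q (-1)"
  proof -
    have "\<forall>y\<in>{-2..0}. h y = 2 powi 0 * y + 0"
      using dyadic_plD(3)[OF h] by simp
    then have "germ 1 h (-1) 0" "germ (-1) h (-1) 0"
      using germ_affineI[of "-2" 0 h 0 0 "-1"] by simp_all
    from Q_iff[OF this] show ?thesis
      using dyadic_plD(3)[OF h, of "-1"] dyadic_rationals_of_int[of 0] by simp
  qed
  ultimately have "Q x"
    by simp
  obtain k l where kl: "germ 1 h x k" "germ (-1) h x l"
    using dyadic_plD(4)[OF h] by blast
  then have *: "h x - 2 powi k * x \<in> dyadic_rationals"
    using \<open>Q x\<close> Q_iff by blast
  show ?thesis
  proof
    assume "x \<in> dyadic_rationals"
    then show "h x \<in> dyadic_rationals"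
      using * change by blast
  next
    assume "h x \<in> dyadic_rationals"
    moreover have "h x - (h x - 2 powi k * x) = 2 powi k * x"
      by simp
    ultimately have "2 powi k * x \<in> dyadic_rationals"
      using dyadic_rationals_diff[of "h x" "h x - 2 powi k * x"] * by (simp only:)
    moreover have "inverse (2 powi k) \<in> dyadic_rationals"
      using dyadic_rationals_powi[of "- k"] by (simp only: power_int_minus)
    ultimately have "inverse (2 powi k) * (2 powi k * x) \<in> dyadic_rationals"
      by (rule dyadic_rationals_mult[rotated])
    moreover have "(2::real) powi k \<noteq> 0"
      by simp
    ultimately show "x \<in> dyadic_rationals"
      by (simp only: mult.assoc[symmetric] left_inverse mult_1_left not_False_eq_True)
  qed
qed

section \<open>Closure properties of the maps of the line\<close>

lemma dyadic_pl_id: "dyadic_pl id"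
  unfolding dyadic_pl_def using germ_id by (auto simp: mono_def)

text \<open>Exponents add. A kink of \<open>f \<circ> g\<close> at \<open>x\<close> comes from a
  kink of \<open>g\<close> at \<open>x\<close> or of \<open>f\<close> at \<open>g x\<close>; in the
  second case \<open>g x\<close> is dyadic, hence so is \<open>x\<close>.\<close>

lemma dyadic_pl_compose:
  assumes f: "dyadic_pl f" and g: "dyadic_pl g"
  shows "dyadic_pl (f \<circ> g)"
  unfolding dyadic_pl_def
proof (intro conjI allI impI)
  show "bij (f \<circ> g)" "mono (f \<circ> g)"
    using dyadic_plD(1,2)[OF f] dyadic_plD(1,2)[OF g] by (auto simp: bij_comp mono_def)
  show "(f \<circ> g) x = x" if "x \<notin> {0<..<1}" for x
    using dyadic_plD(3)[OF f that] dyadic_plD(3)[OF g that] by simp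
  fix x
  obtain k l where kl: "germ 1 g x k" "germ (-1) g x l" "k = l \<or> x \<in> dyadic_rationals"
    using dyadic_plD(4)[OF g] by blast
  obtain k' l' where kl': "germ 1 f (g x) k'" "germ (-1) f (g x) l'" "k' = l' \<or> g x \<in> dyadic_rationals"
    using dyadic_plD(4)[OF f] by blast
  show "\<exists>k l. germ 1 (f \<circ> g) x k \<and> germ (- 1) (f \<circ> g) x l \<and> (k = l \<or> x \<in> dyadic_rationals)"
  proof (intro exI conjI)
    show "germ 1 (f \<circ> g) x (k + k')" "germ (-1) (f \<circ> g) x (l + l')"
      by (rule germ_compose[OF kl(1) kl'(1)], rule germ_compose[OF kl(2) kl'(2)])
    show "k + k' = l + l' \<or> x \<in> dyadic_rationals"
      using kl(3) kl'(3) dyadic_pl_dyadic_iff[OF g, of x] by auto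
  qed
qed

text \<open>A kink of the inverse is the image under \<open>h\<close> of a kink of \<open>h\<close>,
  and \<open>h\<close> preserves dyadic points.\<close>

lemma dyadic_pl_inv:
  assumes h: "dyadic_pl h"
  shows "dyadic_pl (inv_into UNIV h)"
  unfolding dyadic_pl_def
proof (intro conjI allI impI)
  have bij: "bij h" and mono: "mono h"
    using dyadic_plD(1,2)[OF h] by auto
  have hi: "h (inv_into UNIV h y) = y" and ih: "inv_into UNIV h (h y) = y" for y
    by (simp_all add: surj_f_inv_f[OF bij_is_surj[OF bij]] inv_f_f[OF bij_is_inj[OF bij]])
  show "bij (inv_into UNIV h)"
    using bij by (rule bij_imp_bij_inv)
  show "mono (inv_into UNIV h)"
  proof (rule monoI, rule ccontr)
    fix x y assume "x \<le> y" and *: "\<not> inv_into UNIV h x \<le> inv_into UNIV h y"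
    then have "y \<le> x"
      using monoD[OF mono, of "inv_into UNIV h y" "inv_into UNIV h x"] by (simp add: hi)
    then show False
      using \<open>x \<le> y\<close> * by simp
  qed
  show "inv_into UNIV h x = x" if "x \<notin> {0<..<1}" for x
    using dyadic_plD(3)[OF h that] ih[of x] by simp
  fix y
  obtain k l where kl: "germ 1 h (inv_into UNIV h y) k" "germ (-1) h (inv_into UNIV h y) l" "k = l \<or> inv_into UNIV h y \<in> dyadic_rationals"
    using dyadic_plD(4)[OF h] by blast
  show "\<exists>k l. germ 1 (inv_into UNIV h) y k \<and> germ (- 1) (inv_into UNIV h) y l \<and> (k = l \<or> y \<in> dyadic_rationals)"
    using germ_inv[OF bij kl(1)] germ_inv[OF bij kl(2)] kl(3) dyadic_pl_dyadic_iff[OF h, of "inv_into UNIV h y"]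
    unfolding hi by blast
qed

text \<open>Conjugation by the flip of the unit interval turns an element supported on its left half
  into one supported on its right half.\<close>

lemma dyadic_pl_reflect:
  assumes h: "dyadic_pl h"
  shows "dyadic_pl (\<lambda>x. 1 - h (1 - x))"
  unfolding dyadic_pl_def
proof (intro conjI allI impI)
  have "bij (\<lambda>x::real. 1 - x)"
    by (rule o_bij[of "\<lambda>x. 1 - x"]) auto
  then have "bij ((\<lambda>x. 1 - x) \<circ> h \<circ> (\<lambda>x. 1 - x))"
    using dyadic_plD(1)[OF h] by (intro bij_comp)
  then show "bij (\<lambda>x. 1 - h (1 - x))"
    by (simp add: comp_def)
  show "mono (\<lambda>x. 1 - h (1 - x))"
    using dyadic_plD(2)[OF h] by (simp add: mono_def)
  show "1 - h (1 - x) = x" if "x \<notin> {0<..<1}" for x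
  proof -
    have "1 - x \<notin> {0<..<1}"
      using that by auto
    then have "h (1 - x) = 1 - x"
      by (rule dyadic_plD(3)[OF h])
    then show ?thesis
      by simp
  qed
  fix x
  obtain k l where kl: "germ 1 h (1 - x) k" "germ (-1) h (1 - x) l" "k = l \<or> 1 - x \<in> dyadic_rationals"
    using dyadic_plD(4)[OF h] by blast
  have "1 - x \<in> dyadic_rationals \<Longrightarrow> x \<in> dyadic_rationals"
    using dyadic_rationals_diff[of 1 "1 - x"] dyadic_rationals_of_int[of 1] by simp
  then show "\<exists>k l. germ 1 (\<lambda>x. 1 - h (1 - x)) x k \<and> germ (- 1) (\<lambda>x. 1 - h (1 - x)) x l \<and> (k = l \<or> x \<in> dyadic_rationals)"
    using germ_reflect[OF kl(1)] germ_reflect[OF kl(2)] kl(3) by auto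
qed

text \<open>Where the two germs agree, slope and intercept are locally constant, hence constant on
  the interval. The relation \<open>R\<close> in the proof says that two points share both.\<close>

lemma dyadic_pl_affine_between:
  assumes h: "dyadic_pl h" and ab: "a < b"
    and smooth: "\<And>x. x \<in> {a<..<b} \<Longrightarrow> \<exists>k. germ 1 h x k \<and> germ (-1) h x k"
  shows "\<exists>(k::int) c. \<forall>x\<in>{a<..<b}. h x = 2 powi k * x + c"
proof -
  define R where "R x y \<longleftrightarrow> (\<exists>k. germ 1 h x k \<and> germ 1 h y k \<and> h x - 2 powi k * x = h y - 2 powi k * y)"
    for x y
  define m where "m = (a + b) / 2"
  have m: "m \<in> {a<..<b}"
    using ab by (simp add: m_def)
  obtain k where k: "germ 1 h m k"
    using smooth[OF m] by blast
  have "h x = 2 powi k * x + (h m - 2 powi k * m)" if x: "x \<in> {a<..<b}" for x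
  proof -
    have "R m x"
    proof (rule connected_real_equivalence_relation[OF _ _ m x])
      show "R y x" if "R x y" for x y
        using that unfolding R_def by metis
      show "R x z" if "R x y" "R y z" for x y z
      proof -
        obtain k where k: "germ 1 h x k" "germ 1 h y k" "h x - 2 powi k * x = h y - 2 powi k * y"
          using \<open>R x y\<close> unfolding R_def by blast
        obtain k' where k': "germ 1 h y k'" "germ 1 h z k'" "h y - 2 powi k' * y = h z - 2 powi k' * z"
          using \<open>R y z\<close> unfolding R_def by blast
        have "k' = k"
          using germ_unique[OF k'(1) k(2)] by simp
        then show ?thesis
          using k k' unfolding R_def by auto
      qed
      fix x assume x: "x \<in> {a<..<b}"
      obtain e k l where e: "e > 0" "k = l \<or> x \<in> dyadic_rationals" "germ 1 h x k" "germ (-1) h x l"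
      "\<forall>y. x < y \<and> y < x + e \<longrightarrow> h y = h x + 2 powi k * (y - x) \<and> germ 1 h y k \<and> germ (-1) h y k"
      "\<forall>y. x - e < y \<and> y < x \<longrightarrow> h y = h x + 2 powi l * (y - x) \<and> germ 1 h y l \<and> germ (-1) h y l"
        using dyadic_pl_local[OF h, of x] by blast
      have kl: "k = l"
        using smooth[OF x] germ_unique[OF e(3)] germ_unique[OF e(4)] by auto
      have "R x y" if y: "x - e < y" "y < x + e" for y
        unfolding R_def
      proof (intro exI[of _ k] conjI)
        have "h y = h x + 2 powi k * (y - x) \<and> germ 1 h y k"
          using e(3) e(5)[rule_format, of y] e(6)[rule_format, of y] y kl by (cases y x rule: linorder_cases) auto
        then show "germ 1 h y k" "h x - 2 powi k * x = h y - 2 powi k * y"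
          by (auto simp: algebra_simps)
      qed (rule e(3))
      then show "\<exists>e>0. \<forall>y\<in>{a<..<b}. x - e < y \<and> y < x + e \<longrightarrow> R x y"
        using e(1) by blast
    qed auto
    then obtain k' where k': "germ 1 h m k'" "h m - 2 powi k' * m = h x - 2 powi k' * x"
      unfolding R_def by blast
    then show ?thesis
      using germ_unique[OF k k'(1)] by simp
  qed
  then show ?thesis
    by blast
qed

text \<open>Infinitely many kinks would accumulate at some \<open>x\<close>, but the other points
  near \<open>x\<close> lie inside the affine pieces on its two sides.\<close>

lemma finite_dyadic_pl_breaks:
  assumes h: "dyadic_pl h"
  shows "finite {x \<in> {0..1}. \<not> (\<exists>k. germ 1 h x k \<and> germ (-1) h x k)}" (is "finite ?B")
proof (rule ccontr)
  assume "infinite ?B"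
  then obtain x where x: "x islimpt ?B"
    using Heine_Borel_imp_Bolzano_Weierstrass[of "{0..1::real}" ?B] by blast
  obtain e k l where e: "e > 0" "k = l \<or> x \<in> dyadic_rationals" "germ 1 h x k" "germ (-1) h x l"
  "\<forall>y. x < y \<and> y < x + e \<longrightarrow> h y = h x + 2 powi k * (y - x) \<and> germ 1 h y k \<and> germ (-1) h y k"
  "\<forall>y. x - e < y \<and> y < x \<longrightarrow> h y = h x + 2 powi l * (y - x) \<and> germ 1 h y l \<and> germ (-1) h y l"
    using dyadic_pl_local[OF h, of x] by blast
  obtain y where "y \<in> ?B" "y \<in> {x - e<..<x + e}" "y \<noteq> x"
  proof (rule islimptE[OF x, of "{x - e<..<x + e}"])
    show "x \<in> {x - e<..<x + e}"
      using e(1) by simp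
  qed (simp, rule that)
  then show False
    using e(5)[rule_format, of y] e(6)[rule_format, of y] by (cases y x rule: linorder_cases) auto
qed

section \<open>Thompson's group\<close>

text \<open>Extending by the identity gives two one-sided germs at every real point. The kinks that this may
  create at 0 and 1 are dyadic, so they do no harm.\<close>

definition extend_id :: "(real \<Rightarrow> real) \<Rightarrow> real \<Rightarrow> real" where
  "extend_id f x = (if x \<in> {0..1} then f x else x)"

section \<open>Correspondence between maps of the line and elements of F\<close>

lemma extend_id_restrict: "dyadic_pl h \<Longrightarrow> extend_id (restrict h {0..1}) = h"
  by (auto simp: extend_id_def fun_eq_iff dyadic_plD(3))

lemma restrict_extend_id: "f \<in> extensional {0..1} \<Longrightarrow> restrict (extend_id f) {0..1} = f"
  by (auto simp: extend_id_def extensional_def)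

lemma dyadic_pl_bij_betw_unit:
  assumes "dyadic_pl h"
  shows "bij_betw h {0..1} {0..1}"
proof -
  note bij = dyadic_plD(1)[OF assms] and mono = dyadic_plD(2)[OF assms] and out = dyadic_plD(3)[OF assms]
  have ends: "h 0 = 0" "h 1 = 1"
    using out[of 0] out[of 1] by auto
  have "h ` {0..1} = {0..1}"
  proof
    show "h ` {0..1} \<subseteq> {0..1}"
      using monoD[OF mono, of 0] monoD[OF mono, of _ 1] ends by fastforce
    show "{0..1} \<subseteq> h ` {0..1}"
    proof
      fix y :: real assume y: "y \<in> {0..1}"
      obtain x where x: "y = h x"
        using bij by (meson bij_pointE)
      then have "x \<in> {0..1}"
        using out[of x] y by (cases "x \<in> {0<..<1}") auto
      then show "y \<in> h ` {0..1}"
        using x by blast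
    qed
  qed
  then show ?thesis
    using bij by (auto simp: bij_betw_def intro: inj_on_subset)
qed

lemma has_derivative_restrict_iff:
  fixes h :: "real \<Rightarrow> real"
  assumes "x \<in> A"
  shows "(restrict h A has_real_derivative d) (at x within A) \<longleftrightarrow> (h has_real_derivative d) (at x within A)"
  using assms by (auto elim: has_field_derivative_transform_within[OF _ zero_less_one])

lemma restrict_dyadic_pl_thompson_F_maps:
  assumes h: "dyadic_pl h"
  shows "restrict h {0..1} \<in> thompson_F_maps"
proof -
  let ?f = "restrict h {0..1}"
  let ?B = "{x \<in> {0..1}. \<not> (\<exists>k. germ 1 h x k \<and> germ (-1) h x k)}"
  note bij = dyadic_plD(1)[OF h] and mono = dyadic_plD(2)[OF h]
  \<comment> \<open>A monotone map whose range is open has no jumps; here the range is the whole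
    line.\<close>
  have cont: "continuous_on {0..1} h"
  proof (rule continuous_on_subset[OF continuous_onI_mono])
    show "open (range h)"
      using bij by (simp add: bij_is_surj)
  qed (use mono in \<open>auto simp: mono_def\<close>)
  have bb: "bij_betw ?f {0..1} {0..1}"
    using dyadic_pl_bij_betw_unit[OF h] by (subst bij_betw_cong[of _ _ h]) auto
  then have Bij: "?f \<in> Bij {0..1}"
    by (simp add: Bij_def)
  have contf: "continuous_on {0..1} ?f"
    using cont by (subst continuous_on_cong[of _ "{0..1}" _ h]) auto
  have homeo: "\<exists>g. homeomorphism {0..1} {0..1} ?f g"
    using homeomorphism_compact[OF compact_Icc contf bij_betw_imp_surj_on[OF bb] bij_betw_imp_inj_on[OF bb]]
    by metis
  have sm: "strict_mono_on {0..1} ?f"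
  proof (rule strict_mono_onI)
    fix x y :: real assume "x \<in> {0..1}" "y \<in> {0..1}" "x < y"
    moreover have "h x \<noteq> h y"
      using bij \<open>x < y\<close> by (metis bij_is_inj inj_eq less_irrefl)
    moreover have "h x \<le> h y"
      using mono \<open>x < y\<close> by (simp add: monoD)
    ultimately show "?f x < ?f y"
      by simp
  qed
  have pl: "piecewise_linear_unit ?f"
    unfolding piecewise_linear_unit_def
  proof (intro exI[of _ ?B] conjI allI impI)
    fix a b :: real assume ab: "a < b \<and> {a<..<b} \<subseteq> {0..1} - ?B"
    then obtain k c where "\<forall>x\<in>{a<..<b}. h x = 2 powi (k::int) * x + c"
      using dyadic_pl_affine_between[OF h, of a b] by blast
    then have "\<forall>x\<in>{a<..<b}. ?f x = 2 powi k * x + c"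
      using ab by auto
    then show "\<exists>m c. \<forall>x\<in>{a<..<b}. ?f x = m * x + c"
      by blast
  qed (rule finite_dyadic_pl_breaks[OF h])
  \<comment> \<open>Only an inclusion: at 0 and 1 the extended map may have a kink although the
    one-sided derivative of \<open>?f\<close> exists.\<close>
  have nd: "non_diff_points ?f \<subseteq> ?B"
  proof
    fix x assume x: "x \<in> non_diff_points ?f"
    then have x01: "x \<in> {0..1}"
      by (simp add: non_diff_points_def)
    have "\<not> (germ 1 h x k \<and> germ (-1) h x k)" for k
    proof
      assume g: "germ 1 h x k \<and> germ (-1) h x k"
      obtain e k' l where e: "e > 0" "k' = l \<or> x \<in> dyadic_rationals" "germ 1 h x k'" "germ (-1) h x l"
        "\<forall>y. x < y \<and> y < x + e \<longrightarrow> h y = h x + 2 powi k' * (y - x) \<and> germ 1 h y k' \<and> germ (-1) h y k'"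
        "\<forall>y. x - e < y \<and> y < x \<longrightarrow> h y = h x + 2 powi l * (y - x) \<and> germ 1 h y l \<and> germ (-1) h y l"
        using dyadic_pl_local[OF h, of x] by blast
      have kl: "k' = k" "l = k"
        using g germ_unique[OF e(3)] germ_unique[OF e(4)] by auto
      have "((\<lambda>y. h x + 2 powi k * (y - x)) has_real_derivative 2 powi k) (at x within {0..1})"
        by (auto intro!: derivative_eq_intros)
      then have "(?f has_real_derivative 2 powi k) (at x within {0..1})"
      proof (rule has_field_derivative_transform_within)
        fix y :: real assume "y \<in> {0..1}" "dist y x < e"
        then show "h x + 2 powi k * (y - x) = ?f y"
          using e(5)[rule_format, of y] e(6)[rule_format, of y] kl
          by (cases y x rule: linorder_cases) (auto simp: dist_real_def abs_if)
      qed (use e(1) x01 in auto)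
      then show False
        using x by (auto simp: non_diff_points_def real_differentiable_def)
    qed
    then show "x \<in> ?B"
      using x01 by blast
  qed
  have breaks: "?B \<subseteq> dyadic_rationals"
    using dyadic_plD(4)[OF h] by blast
  have slopes: "\<exists>k::int. d = 2 powi k"
    if x: "x \<in> {0..1}" and d: "(?f has_real_derivative d) (at x within {0..1})" for x d
  proof -
    have d: "(h has_real_derivative d) (at x within {0..1})"
      using d has_derivative_restrict_iff[OF x] by blast
    obtain k l where kl: "germ 1 h x k" "germ (-1) h x l"
      using dyadic_plD(4)[OF h] by blast
    \<comment> \<open>The right germ lies in the unit interval except at 1, where the left one is
      used.\<close>
    show ?thesis
    proof (cases "x < 1")
      case True
      then show ?thesis
        using germ_has_derivative[OF kl(1) _ d, of "1 - x"] x by auto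
    next
      case False
      then show ?thesis
        using germ_has_derivative[OF kl(2) _ d, of 1] x by auto
    qed
  qed
  show ?thesis
    unfolding thompson_F_maps_def
    using Bij homeo sm pl finite_subset[OF nd finite_dyadic_pl_breaks[OF h]] nd breaks slopes by blast
qed

text \<open>A finite set leaves an interval next to \<open>x\<close> free, on which \<open>f\<close>
  is affine. Continuity carries the formula over to \<open>x\<close>, and the slope is a power of 2
  because it is a derivative inside the interval.\<close>

lemma thompson_F_maps_ex_germ:
  assumes f: "f \<in> thompson_F_maps" and x: "x \<in> {0..1}" and \<sigma>: "\<sigma> \<in> {1, -1}"
    and r: "r > 0" "\<And>t. 0 < t \<Longrightarrow> t < r \<Longrightarrow> x + \<sigma> * t \<in> {0..1}"
  shows "\<exists>k. germ \<sigma> f x k"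
proof -
  have cont: "continuous_on {0..1} f"
    using f by (auto simp: thompson_F_maps_def homeomorphism_def)
  have "piecewise_linear_unit f"
    using f by (simp add: thompson_F_maps_def)
  then obtain P where P: "finite P"
    "\<And>a b. a < b \<Longrightarrow> {a<..<b} \<subseteq> {0..1} - P \<Longrightarrow> \<exists>m c. \<forall>x\<in>{a<..<b}. f x = m * x + c"
    unfolding piecewise_linear_unit_def by blast
  obtain e0 where e0: "e0 > 0" "\<And>y. y \<in> P \<Longrightarrow> y \<noteq> x \<Longrightarrow> e0 \<le> dist x y"
    using finite_set_avoid[OF P(1), of x] by blast
  define e where "e = min r e0"
  have e: "e > 0"
    using r(1) e0(1) by (simp add: e_def)
  define I where "I = (if \<sigma> = 1 then {x<..<x+e} else {x-e<..<x})"
  have I_iff: "y \<in> I \<longleftrightarrow> (\<exists>t. 0 < t \<and> t < e \<and> y = x + \<sigma> * t)" for y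
    using \<sigma> e by (auto simp: I_def intro: exI[of _ "y - x"] exI[of _ "x - y"])
  have I: "I \<subseteq> {0..1} - P"
  proof
    fix y assume "y \<in> I"
    then obtain t where t: "0 < t" "t < e" "y = x + \<sigma> * t"
      by (auto simp: I_iff)
    then have "y \<noteq> x" "dist x y < e0"
      using \<sigma> by (auto simp: dist_real_def e_def)
    then show "y \<in> {0..1} - P"
      using r(2)[of t] t e0(2)[of y] by (auto simp: e_def)
  qed
  then obtain m c where mc: "\<And>y. y \<in> I \<Longrightarrow> f y = m * y + c"
    using P(2)[of x "x + e"] P(2)[of "x - e" x] e by (auto simp: I_def split: if_splits) 
  have ev: "eventually (\<lambda>t. 0 < t \<and> t < e) (at_right (0::real))"
    using e by (auto intro: eventually_at_rightI[of 0 e])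
  have "filterlim (\<lambda>t. x + \<sigma> * t) (at x within {0..1}) (at_right 0)"
    unfolding filterlim_at
  proof
    show "\<forall>\<^sub>F t in at_right 0. x + \<sigma> * t \<in> {0..1} \<and> x + \<sigma> * t \<noteq> x"
      using ev by eventually_elim (use r(2) \<sigma> in \<open>auto simp: e_def\<close>)
    show "((\<lambda>t. x + \<sigma> * t) \<longlongrightarrow> x) (at_right 0)"
      by (auto intro!: tendsto_eq_intros)
  qed
  moreover have "(f \<longlongrightarrow> f x) (at x within {0..1})"
    using cont x by (simp add: continuous_on_def)
  ultimately have "((\<lambda>t. f (x + \<sigma> * t)) \<longlongrightarrow> f x) (at_right 0)"
    by (rule filterlim_compose[rotated])
  moreover have "\<forall>\<^sub>F t in at_right 0. f (x + \<sigma> * t) = m * (x + \<sigma> * t) + c"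
    using ev by eventually_elim (use mc I_iff in blast)
  ultimately have "((\<lambda>t. m * (x + \<sigma> * t) + c) \<longlongrightarrow> f x) (at_right 0)"
    by (rule Lim_transform_eventually)
  moreover have "((\<lambda>t. m * (x + \<sigma> * t) + c) \<longlongrightarrow> m * x + c) (at_right 0)"
    by (auto intro!: tendsto_eq_intros)
  ultimately have fx: "f x = m * x + c"
    using tendsto_unique[OF trivial_limit_at_right_real] by blast
  \<comment> \<open>The slope is read off in the middle of \<open>I\<close>, since \<open>f\<close>
    may fail to be differentiable at \<open>x\<close>.\<close>
  define y where "y = x + \<sigma> * (e / 2)"
  have y: "y \<in> I"
    using e by (auto simp: I_iff y_def intro!: exI[of _ "e / 2"])
  have "open I"
    by (simp add: I_def)
  have "((\<lambda>y. m * y + c) has_real_derivative m) (at y)"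
    by (auto intro!: derivative_eq_intros)
  then have "(f has_real_derivative m) (at y)"
    using \<open>open I\<close> y by (rule has_field_derivative_transform_within_open) (simp add: mc)
  then have "(f has_real_derivative m) (at y within {0..1})"
    by (rule has_field_derivative_at_within)
  then obtain k :: int where k: "m = 2 powi k"
    using f y I unfolding thompson_F_maps_def by blast
  have "f (x + \<sigma> * t) = f x + \<sigma> * (2 powi k * t)" if "0 \<le> t" "t < e" for t
  proof (cases "t = 0")
    case False
    with that have "0 < t \<and> t < e \<and> x + \<sigma> * t = x + \<sigma> * t"
      by simp
    then have "x + \<sigma> * t \<in> I"
      unfolding I_iff by blast
    then show ?thesis
      using mc fx k by (simp add: algebra_simps)
  qed simp
  then show ?thesis
    unfolding germ_def using e by blast
qed

lemma dyadic_pl_extend_id: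
  assumes f: "f \<in> thompson_F_maps"
  shows "dyadic_pl (extend_id f)"
proof -
  let ?h = "extend_id f"
  have bb: "bij_betw f {0..1} {0..1}" and sm: "strict_mono_on {0..1} f"
    using f by (auto simp: thompson_F_maps_def Bij_def)
  have range: "f x \<in> {0..1}" if "x \<in> {0..1}" for x
    using bb that by (rule bij_betwE[rule_format])
  have mono: "f x \<le> f y" if "x \<in> {0..1}" "y \<in> {0..1}" "x \<le> y" for x y
    using strict_mono_onD[OF sm that(1,2)] that(3) by (cases "x = y") auto
  \<comment> \<open>Monotonicity squeezes \<open>f 0\<close> below \<open>f x0 = 0\<close> and
    \<open>f 1\<close> above \<open>f x1 = 1\<close>.\<close>
  obtain x0 x1 where "x0 \<in> {0..1}" "f x0 = 0" "x1 \<in> {0..1}" "f x1 = 1"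
    using bij_betw_imp_surj_on[OF bb] by (metis (no_types) atLeastAtMost_iff imageE order_refl zero_le_one)
  then have ends: "f 0 = 0" "f 1 = 1"
    using mono[of 0 x0] mono[of x1 1] range[of 0] range[of 1] by auto
  have "bij_betw ?h {0..1} {0..1}"
    using bb by (subst bij_betw_cong[of _ _ f]) (auto simp: extend_id_def)
  moreover have "bij_betw ?h (- {0..1}) (- {0..1})"
    by (subst bij_betw_cong[of _ _ id]) (auto simp: extend_id_def)
  ultimately have "bij ?h"
    using bij_betw_combine[of ?h "{0..1}" "{0..1}" "- {0..1}" "- {0..1}"] by (simp add: Compl_partition)
  moreover have "mono ?h"
  proof (rule monoI)
    fix x y :: real assume "x \<le> y"
    then show "?h x \<le> ?h y"
      using mono[of x y] range[of x] range[of y] by (auto simp: extend_id_def)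
  qed
  moreover have "?h x = x" if "x \<notin> {0<..<1}" for x
    using that ends by (cases "x = 0 \<or> x = 1") (auto simp: extend_id_def)
  moreover have "\<exists>k l. germ 1 ?h x k \<and> germ (-1) ?h x l \<and> (k = l \<or> x \<in> dyadic_rationals)" for x
  proof -
    have right: "\<exists>k. germ 1 f x k \<and> germ 1 ?h x k" if x: "0 \<le> x" "x < 1"
    proof -
      obtain k where k: "germ 1 f x k"
        using thompson_F_maps_ex_germ[OF f, of x 1 "1 - x"] x by auto
      have "germ 1 ?h x k"
        using k x by (rule_tac germ_cong[of 1 f x k _ "1 - x"]) (auto simp: extend_id_def)
      with k show ?thesis by blast
    qed
    have left: "\<exists>k. germ (-1) f x k \<and> germ (-1) ?h x k" if x: "0 < x" "x \<le> 1"
    proof -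
      obtain k where k: "germ (-1) f x k"
        using thompson_F_maps_ex_germ[OF f, of x "-1" x] x by auto
      have "germ (-1) ?h x k"
        using k x by (rule_tac germ_cong[of "-1" f x k _ x]) (auto simp: extend_id_def)
      with k show ?thesis by blast
    qed
    have right_id: "germ 1 ?h x 0" if "x < 0 \<or> 1 \<le> x"
    proof (rule germ_cong[OF germ_id])
      show "0 < (if x < 0 then - x else 1)"
        using that by simp
    qed (use that ends in \<open>auto simp: extend_id_def split: if_splits\<close>)
    have left_id: "germ (-1) ?h x 0" if "x \<le> 0 \<or> 1 < x"
    proof (rule germ_cong[OF germ_id])
      show "0 < (if 1 < x then x - 1 else 1)"
        using that by simp
    qed (use that ends in \<open>auto simp: extend_id_def split: if_splits\<close>)
    consider "x < 0 \<or> 1 < x" | "x = 0" | "x = 1" | "0 < x" "x < 1"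
      by linarith
    then show ?thesis
    proof cases
      case 1
      then show ?thesis
        using right_id left_id by (intro exI[of _ 0]) auto
    next
      case 2
      then show ?thesis
        using right left_id dyadic_rationals_of_int[of 0] by auto
    next
      case 3
      then show ?thesis
        using right_id left dyadic_rationals_of_int[of 1] by auto
    next
      case 4
      then obtain k l where k: "germ 1 f x k" "germ 1 ?h x k" and l: "germ (-1) f x l" "germ (-1) ?h x l"
        using right left by auto
      \<comment> \<open>A derivative at \<open>x\<close> would equal both one-sided slopes, so
        \<open>x\<close> is a non-differentiable point and therefore dyadic.\<close>
      have "x \<in> dyadic_rationals" if "k \<noteq> l"
      proof -
        have "\<not> f differentiable at x within {0..1}"
        proof
          assume "f differentiable at x within {0..1}"
          then obtain d where d: "(f has_real_derivative d) (at x within {0..1})"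
            unfolding real_differentiable_def by blast
          have "d = 2 powi k" "d = 2 powi l"
            using germ_has_derivative[OF k(1) _ d, of "1 - x"] germ_has_derivative[OF l(1) _ d, of x] 4 by auto
          then show False
            using that by (simp add: two_powi_inject)
        qed
        then have "x \<in> non_diff_points f"
          using 4 by (simp add: non_diff_points_def)
        then show ?thesis
          using f by (auto simp: thompson_F_maps_def)
      qed
      then show ?thesis
        using k l by blast
    qed
  qed
  ultimately show ?thesis
    unfolding dyadic_pl_def by blast
qed

section \<open>The group structure\<close>

lemma thompson_F_maps_Bij: "f \<in> thompson_F_maps \<Longrightarrow> f \<in> Bij {0..1}"
  by (simp add: thompson_F_maps_def)

lemma extend_id_compose:
  assumes "f \<in> thompson_F_maps" "g \<in> thompson_F_maps"
  shows "extend_id (compose {0..1} f g) = extend_id f \<circ> extend_id g"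
proof
  fix x
  have "g x \<in> {0..1}" if "x \<in> {0..1}"
    using Bij_imp_funcset[OF thompson_F_maps_Bij[OF assms(2)]] that by (rule funcset_mem)
  then show "extend_id (compose {0..1} f g) x = (extend_id f \<circ> extend_id g) x"
    by (simp add: extend_id_def compose_def del: atLeastAtMost_iff)
qed

lemma thompson_F_simps [simp]:
  "carrier thompson_F = thompson_F_maps"
  "f \<in> thompson_F_maps \<Longrightarrow> g \<in> thompson_F_maps \<Longrightarrow> f \<otimes>\<^bsub>thompson_F\<^esub> g = compose {0..1} f g"
  using thompson_F_maps_Bij by (simp_all add: thompson_F_def BijGroup_def)

text \<open>Products and inverses are formed on the line, where \<open>dyadic_pl\<close> is closed
  under them, and restricted back to the unit interval.\<close>

lemma group_thompson_F: "group thompson_F"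
proof -
  interpret group "BijGroup {0..1::real}"
    by (rule group_BijGroup)
  have "subgroup thompson_F_maps (BijGroup {0..1})"
  proof (rule subgroupI)
    show "thompson_F_maps \<subseteq> carrier (BijGroup {0..1})"
      by (auto simp: BijGroup_def thompson_F_maps_Bij)
    show "thompson_F_maps \<noteq> {}"
      using restrict_dyadic_pl_thompson_F_maps[OF dyadic_pl_id] by blast
  next
    fix f assume f: "f \<in> thompson_F_maps"
    let ?h = "extend_id f"
    have h: "dyadic_pl ?h"
      using f by (rule dyadic_pl_extend_id)
    have "inv_into {0..1} f y = inv_into UNIV ?h y" if y: "y \<in> {0..1}" for y
    proof -
      have bb: "bij_betw f {0..1} {0..1}"
        using thompson_F_maps_Bij[OF f] by (simp add: Bij_def)
      then have "y \<in> f ` {0..1}"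
        using y by (simp only: bij_betw_imp_surj_on)
      then obtain x where x: "x \<in> {0..1}" "f x = y"
        by blast
      then have "?h x = y"
        by (simp add: extend_id_def)
      then have "inv_into UNIV ?h y = x"
        by (rule inv_f_eq[OF bij_is_inj[OF dyadic_plD(1)[OF h]]])
      moreover have "inv_into {0..1} f y = x"
        by (rule inv_into_f_eq[OF bij_betw_imp_inj_on[OF bb] x])
      ultimately show ?thesis
        by simp
    qed
    then have "restrict (inv_into {0..1} f) {0..1} = restrict (inv_into UNIV ?h) {0..1}"
      by (rule restrict_ext)
    then have "inv\<^bsub>BijGroup {0..1}\<^esub> f = restrict (inv_into UNIV ?h) {0..1}"
      using inv_BijGroup[OF thompson_F_maps_Bij[OF f]] by simp
    then show "inv\<^bsub>BijGroup {0..1}\<^esub> f \<in> thompson_F_maps"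
      using restrict_dyadic_pl_thompson_F_maps[OF dyadic_pl_inv[OF h]] by simp
  next
    fix f g assume fg: "f \<in> thompson_F_maps" "g \<in> thompson_F_maps"
    let ?c = "compose {0..1} f g"
    have "dyadic_pl (extend_id ?c)"
      unfolding extend_id_compose[OF fg] by (intro dyadic_pl_compose dyadic_pl_extend_id fg)
    then have "restrict (extend_id ?c) {0..1} \<in> thompson_F_maps"
      by (rule restrict_dyadic_pl_thompson_F_maps)
    then have "?c \<in> thompson_F_maps"
      by (simp add: restrict_extend_id)
    then show "f \<otimes>\<^bsub>BijGroup {0..1}\<^esub> g \<in> thompson_F_maps"
      using fg by (simp add: BijGroup_def thompson_F_maps_Bij)
  qed
  then show ?thesis
    unfolding thompson_F_def by (rule subgroup_imp_group)
qed

section \<open>The slopes at the two end points\<close>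

definition log_slope :: "real \<Rightarrow> real \<Rightarrow> (real \<Rightarrow> real) \<Rightarrow> int" where
  "log_slope \<sigma> x f = (THE k. germ \<sigma> (extend_id f) x k)"

lemma log_slope_eqI: "germ \<sigma> (extend_id f) x k \<Longrightarrow> \<sigma> \<noteq> 0 \<Longrightarrow> log_slope \<sigma> x f = k"
  unfolding log_slope_def by (rule the_equality) (auto dest: germ_unique)

text \<open>All elements fix \<open>x\<close>, so both factors have their germs at the same point
  and the exponents add.\<close>

lemma log_slope_hom:
  assumes \<sigma>: "\<sigma> \<in> {1, -1}" and x: "x \<notin> {0<..<1}"
  shows "log_slope \<sigma> x \<in> hom thompson_F integer_group"
proof (rule homI)
  fix f g assume "f \<in> carrier thompson_F" "g \<in> carrier thompson_F"
  then have fg: "f \<in> thompson_F_maps" "g \<in> thompson_F_maps"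
    by simp_all
  have ex: "\<exists>k. germ \<sigma> (extend_id h) x k" if "h \<in> thompson_F_maps" for h
    using dyadic_plD(4)[OF dyadic_pl_extend_id[OF that], of x] \<sigma> by auto
  obtain k l where kl: "germ \<sigma> (extend_id f) x k" "germ \<sigma> (extend_id g) x l"
    using ex fg by blast
  have "extend_id g x = x"
    using dyadic_plD(3)[OF dyadic_pl_extend_id[OF fg(2)] x] .
  then have "germ \<sigma> (extend_id (f \<otimes>\<^bsub>thompson_F\<^esub> g)) x (l + k)"
    using germ_compose[OF kl(2), of "extend_id f" k] kl(1) by (simp add: fg extend_id_compose)
  then show "log_slope \<sigma> x (f \<otimes>\<^bsub>thompson_F\<^esub> g) = log_slope \<sigma> x f \<otimes>\<^bsub>integer_group\<^esub> log_slope \<sigma> x g"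
    using log_slope_eqI kl \<sigma> by force
qed simp

text \<open>The inverse of the standard generator of F with slopes 1/2, 1, 2, scaled to the left
  half of the interval. The inner \<open>min\<close> is the concave map with slopes 2, 1, 1/2;
  outside that half it is below \<open>x\<close>, and \<open>max\<close> restores the
  identity.\<close>

definition left_bump :: "real \<Rightarrow> real" where
  "left_bump x = max x (min (2 * x) (min (x + 1/8) (x/2 + 1/4)))"

text \<open>The pieces have the shape that \<open>germ_affineI\<close> expects; the free
  \<open>a\<close> and \<open>b\<close> stand for the unbounded ends.\<close>

lemma left_bump_eq:
  "\<forall>x\<in>{a..0}. left_bump x = 2 powi 0 * x + 0"
  "\<forall>x\<in>{0..1/8}. left_bump x = 2 powi 1 * x + 0"
  "\<forall>x\<in>{1/8..1/4}. left_bump x = 2 powi 0 * x + 1/8"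
  "\<forall>x\<in>{1/4..1/2}. left_bump x = 2 powi (-1) * x + 1/4"
  "\<forall>x\<in>{1/2..b}. left_bump x = 2 powi 0 * x + 0"
  by (auto simp: left_bump_def)

lemma left_bump_germ:
  "x < 0 \<Longrightarrow> germ 1 left_bump x 0" "x \<le> 0 \<Longrightarrow> germ (-1) left_bump x 0"
  "0 \<le> x \<Longrightarrow> x < 1/8 \<Longrightarrow> germ 1 left_bump x 1" "0 < x \<Longrightarrow> x \<le> 1/8 \<Longrightarrow> germ (-1) left_bump x 1"
  "1/8 \<le> x \<Longrightarrow> x < 1/4 \<Longrightarrow> germ 1 left_bump x 0" "1/8 < x \<Longrightarrow> x \<le> 1/4 \<Longrightarrow> germ (-1) left_bump x 0"
  "1/4 \<le> x \<Longrightarrow> x < 1/2 \<Longrightarrow> germ 1 left_bump x (-1)" "1/4 < x \<Longrightarrow> x \<le> 1/2 \<Longrightarrow> germ (-1) left_bump x (-1)"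
  "1/2 \<le> x \<Longrightarrow> germ 1 left_bump x 0" "1/2 < x \<Longrightarrow> germ (-1) left_bump x 0"
  using germ_affineI[OF left_bump_eq(1)[of "x - 1"], of x]
    germ_affineI[OF left_bump_eq(2), of x] germ_affineI[OF left_bump_eq(3), of x]
    germ_affineI[OF left_bump_eq(4), of x] germ_affineI[OF left_bump_eq(5)[of "x + 1"], of x]
  by simp_all

lemma dyadic_pl_left_bump: "dyadic_pl left_bump"
  unfolding dyadic_pl_def
proof (intro conjI allI impI)
  show "bij left_bump"
  proof (rule bijI)
    have "left_bump x < left_bump y" if "x < y" for x y
      unfolding left_bump_def using that by linarith
    then have "strict_mono left_bump"
      by (rule strict_monoI)
    then show "inj left_bump"
      by (rule strict_mono_imp_inj_on)
    show "surj left_bump"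
      unfolding surj_def
    proof
      fix y :: real
      \<comment> \<open>The breaks 1/8, 1/4, 1/2 are mapped to 1/4, 3/8, 1/2; the witnesses below
        invert the affine pieces.\<close>
      consider "y \<le> 0 \<or> 1/2 \<le> y" | "0 \<le> y" "y \<le> 1/4" | "1/4 \<le> y" "y \<le> 3/8" | "3/8 \<le> y" "y \<le> 1/2"
        by linarith
      then show "\<exists>x. y = left_bump x"
      proof cases
        case 1
        then show ?thesis
          by (intro exI[of _ y]) (auto simp: left_bump_def)
      next
        case 2
        then show ?thesis
          using bspec[OF left_bump_eq(2), of "y / 2"] by (intro exI[of _ "y / 2"]) simp
      next
        case 3
        then show ?thesis
          using bspec[OF left_bump_eq(3), of "y - 1/8"] by (intro exI[of _ "y - 1/8"]) simp
      next
        case 4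
        then show ?thesis
          using bspec[OF left_bump_eq(4), of "2 * y - 1/2"]
          by (intro exI[of _ "2 * y - 1/2"]) (simp add: power_int_minus field_simps)
      qed
    qed
  qed
  show "mono left_bump"
    by (rule monoI) (auto simp: left_bump_def)
  show "left_bump x = x" if "x \<notin> {0<..<1}" for x
    using that by (auto simp: left_bump_def)
  fix x :: real
  have "1/2 \<in> dyadic_rationals" "1/4 \<in> dyadic_rationals" "1/8 \<in> dyadic_rationals"
    using dyadic_rationalsI[of 1 1] dyadic_rationalsI[of 1 2] dyadic_rationalsI[of 1 3] by simp_all
  moreover note dyadic_rationals_of_int[of 0]
  ultimately have breaks: "{0, 1/8, 1/4, 1/2} \<subseteq> dyadic_rationals"
    by simp
  have *: "\<exists>k l. germ 1 left_bump x k \<and> germ (-1) left_bump x l \<and> (k = l \<or> x \<in> dyadic_rationals)"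
    if "germ 1 left_bump x k" "germ (-1) left_bump x l" "k = l \<or> x \<in> {0, 1/8, 1/4, 1/2}" for k l
    using that breaks by blast
  consider "x < 0" | "x = 0" | "0 < x" "x < 1/8" | "x = 1/8" | "1/8 < x" "x < 1/4" | "x = 1/4"
    | "1/4 < x" "x < 1/2" | "x = 1/2" | "1/2 < x"
    by linarith
  then show "\<exists>k l. germ 1 left_bump x k \<and> germ (-1) left_bump x l \<and> (k = l \<or> x \<in> dyadic_rationals)"
  proof cases
    case 1 then show ?thesis by (intro *[OF left_bump_germ(1,2)]) auto
  next
    case 2 then show ?thesis by (intro *[OF left_bump_germ(3,2)]) auto
  next
    case 3 then show ?thesis by (intro *[OF left_bump_germ(3,4)]) auto
  next
    case 4 then show ?thesis by (intro *[OF left_bump_germ(5,4)]) auto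
  next
    case 5 then show ?thesis by (intro *[OF left_bump_germ(5,6)]) auto
  next
    case 6 then show ?thesis by (intro *[OF left_bump_germ(7,6)]) auto
  next
    case 7 then show ?thesis by (intro *[OF left_bump_germ(7,8)]) auto
  next
    case 8 then show ?thesis by (intro *[OF left_bump_germ(9,8)]) auto
  next
    case 9 then show ?thesis by (intro *[OF left_bump_germ(9,10)]) auto
  qed
qed

theorem theorem1p7:
  fixes S :: "(real \<Rightarrow> real) set"
  assumes "finite_generating_set thompson_F S"
  shows "wCop (Cay thompson_F S) = \<infinity>"
proof -
  let ?R = "\<lambda>h. restrict h {0..1::real}"
  define right_bump where "right_bump x = 1 - left_bump (1 - x)" for x
  have pl: "dyadic_pl left_bump" "dyadic_pl right_bump"
    using dyadic_pl_left_bump dyadic_pl_reflect[OF dyadic_pl_left_bump] by (simp_all add: right_bump_def[abs_def])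
  have ext: "extend_id (?R left_bump) = left_bump" "extend_id (?R right_bump) = right_bump"
    by (rule extend_id_restrict, rule pl)+
  have mem: "?R left_bump \<in> thompson_F_maps" "?R right_bump \<in> thompson_F_maps"
    by (rule restrict_dyadic_pl_thompson_F_maps, rule pl)+
  have left: "left_bump x = x" if "1/2 \<le> x" for x
    using bspec[OF left_bump_eq(5)[of x], of x] that by simp
  have left_le: "left_bump x \<le> 1/2" if "x \<le> 1/2" for x
    unfolding left_bump_def using that by linarith
  have right: "right_bump x = x" if "x \<le> 1/2" for x
    using left[of "1 - x"] that by (simp add: right_bump_def)
  have right_ge: "1/2 \<le> right_bump x" if "1/2 \<le> x" for x
    using left_le[of "1 - x"] that by (simp add: right_bump_def)
  have "left_bump (right_bump x) = right_bump (left_bump x)" for x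
  proof (cases "x \<le> 1/2")
    case True
    then show ?thesis
      using right[OF True] right[OF left_le[OF True]] by simp
  next
    case False
    then have "1/2 \<le> x"
      by simp
    then show ?thesis
      using left[OF \<open>1/2 \<le> x\<close>] left[OF right_ge[OF \<open>1/2 \<le> x\<close>]] by simp
  qed
  then have "extend_id (?R left_bump \<otimes>\<^bsub>thompson_F\<^esub> ?R right_bump) = extend_id (?R right_bump \<otimes>\<^bsub>thompson_F\<^esub> ?R left_bump)"
    by (simp only: thompson_F_simps(2)[OF mem] thompson_F_simps(2)[OF mem(2,1)] extend_id_compose mem ext
          comp_def fun_eq_iff simp_thms)
  \<comment> \<open>Elements of F are extensional, so their extensions to the line determine
    them.\<close>
  then have comm: "?R left_bump \<otimes>\<^bsub>thompson_F\<^esub> ?R right_bump = ?R right_bump \<otimes>\<^bsub>thompson_F\<^esub> ?R left_bump"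
    by (metis compose_extensional mem restrict_extend_id thompson_F_simps(2))
  have "germ 1 left_bump 0 1" "germ (-1) left_bump 1 0" "germ 1 left_bump 1 0" "germ (-1) left_bump 0 0"
    by (simp_all add: left_bump_germ)
  \<comment> \<open>The flip exchanges the points 0 and 1 as well as the two sides.\<close>
  then have germs: "germ 1 left_bump 0 1" "germ (-1) left_bump 1 0" "germ 1 right_bump 0 0" "germ (-1) right_bump 1 1"
    using germ_reflect[of "-1" left_bump 0 0] germ_reflect[of 1 left_bump 1 1]
     by (simp_all add: right_bump_def[abs_def])
  show ?thesis
    using mem comm germs
    by (intro group.wCop_Cay_eq_infinity[OF group_thompson_F assms log_slope_hom[of 1 0] log_slope_hom[of "-1" 1],
          of "?R left_bump" "?R right_bump"]) (auto intro!: log_slope_eqI simp: ext)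
qed

end
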